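(* Let $X\in\{B,C\}$, $n\ge1$ and $w\in W(X_n)$. Then $$\mathcal G^X_{n,w}(a,b;x)=\sum_{\mathbf D\in\mathrm{RSub}(\Delta^X_n,w)}\mathrm{Wt}^X_n(\mathbf D),\qquad \mathrm{Wt}^X_n(\mathbf D)=\prod_{d\in\mathbf D}\mathrm{wt}^X_n(d)\times\prod_{d\in B(\mathbf D)}\big(1+\beta\,\mathrm{wt}^X_n(d)\big).$$
   Context: Let $\beta$ be an indeterminate, $x\oplus y=x+y+\beta xy$, $\bar x=-x/(1+\beta x)$. $W(B_n)=W(C_n)$ is the group of signed permutations of $\{\pm1,\dots,\pm n\}$ generated by $s_0$ (sign change of the first entry) and $s_i=(i,i+1)$, $1\le i\le n-1$, with $(s_0s_1)^4=1$, $(s_0s_i)^2=1$ for $i\ge2$. $\mathrm{Id}_\beta(W)$: the $\mathbb Z[\beta]$-algebra with generators $u_i$, $u_i^2=\beta u_i$ and the braid relations; $u_w$ for reduced words. Variables commute with $u_i$; $h_i(x)=1+xu_i$, $A^{(n)}_i(x)=h_{n-1}(x)\cdots h_i(x)$, $G_{A_{n-1}}(a_1,\dots,a_{n-1})=A^{(n)}_1(a_1)\cdots A^{(n)}_{n-1}(a_{n-1})$, $F^B_n(x)=h_{n-1}(x)\cdots h_1(x)h_0(x)h_1(x)\cdots h_{n-1}(x)$, $F^C_n(x)$ the same with $h_0(x)$ replaced by $h_0(x)^2$, $F^X_n(x_1,\dots,x_n)=\prod_{i=1}^nF^X_n(x_i)$. $\mathcal G^X_{n,w}(a,b;x)$ is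 the coefficient of $u_w$ in $G_{A_{n-1}}(\bar b_1,\dots,\bar b_{n-1})^{-1}F^X_n(x_1,\dots,x_n)G_{A_{n-1}}(a_1,\dots,a_{n-1})$. $\Delta^X_n$ (the same sequence for $X=B,C$) is the sequence of boxes listed as follows: first, for $j=2n-1,2n-2,\dots,n+1$ and for each $j$, $i=1,\dots,2n-j$; then, for $j=n,n-1,\dots,1$ and for each $j$, $i=n+1-j,\dots,2n-j$. The box at $(i,j)$ carries the simple reflection $s_{i+j-n-1}$ (so as a word $\Delta^X_n$ is $(s_{n-1}\,|\,s_{n-2},s_{n-1}\,|\cdots|\,s_1,\dots,s_{n-1})$ followed by $(s_0,s_1,\dots,s_{n-1})$ repeated $n$ times). Put $p_i=x_{n+1-i}$ ($1\le i\le n$), $p_i=a_{i-n}$ ($i>n$), $q_j=x_j$ ($1\le j\le n$), $q_j=b_{j-n}$ ($j>n$). Weights: $\mathrm{wt}^C_n$ of the box $(i,j)$ is $p_i\oplus q_j$; $\mathrm{wt}^B_n$ equals $\mathrm{wt}^C_n$ except that the box $(i,n+1-i)$ has $\mathrm{wt}^B_n=x_{n+1-i}$. For a sequence $\Delta=(d_1,\dots,d_N)$ of simple reflections and $w$ of length $\ell$, $\mathrm{RSub}(\Delta,w)$ is the set of subsequences $\mathbf D=(d_{j_1},\dots,d_{j_\ell})$, $j_1<\cdots<j_\ell$, with $d_{j_1}\cdots d_{j_\ell}=w$. With $j_{\ell+1}=N+1$, $B(\mathbf D)$ is the set of positions $j\le N$ such that $j_p<j<j_{p+1}$ for some $p$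 and $\ell(d_{j_1}\cdots d_{j_p}d_j)<\ell(d_{j_1}\cdots d_{j_p})$ (i.e. $(d_{j_1}\cdots d_{j_p})\star d_j=d_{j_1}\cdots d_{j_p}$ for the Demazure product $\star$). *)

theory Defs
  imports
    "HOL-Library.Poly_Mapping"
    "HOL-Library.Product_Lexorder"
    "HOL-Computational_Algebra.Fraction_Field"
    "HOL-Combinatorics.Permutations"
    "HOL-Algebra.QuotRing"
begin

section \<open>Signed permutations\<close>

definition signed_perms :: "nat \<Rightarrow> (int \<Rightarrow> int) set" where
  "signed_perms n =
     {w. w permutes ({- int n..int n} - {0}) \<and> (\<forall>k. w (- k) = - w k)}"

definition refl_gen :: "nat \<Rightarrow> int \<Rightarrow> int" where
  "refl_gen i =
     (if i = 0 then Transposition.transpose (- 1) 1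
      else Transposition.transpose (int i) (int i + 1) \<circ>
           Transposition.transpose (- int i) (- int i - 1))"

definition word_perm :: "nat list \<Rightarrow> int \<Rightarrow> int" where
  "word_perm is = foldr (\<lambda>i w. refl_gen i \<circ> w) is id"

definition cox_length :: "nat \<Rightarrow> (int \<Rightarrow> int) \<Rightarrow> nat" where
  "cox_length n w =
     (LEAST l. \<exists>is. set is \<subseteq> {..<n} \<and> length is = l \<and> word_perm is = w)"

definition is_reduced_word :: "nat \<Rightarrow> (int \<Rightarrow> int) \<Rightarrow> nat list \<Rightarrow> bool" where
  "is_reduced_word n w is \<longleftrightarrow>
     set is \<subseteq> {..<n} \<and> word_perm is = w \<and> length is = cox_length n w"


section \<open>The algebra \<open>Id\<^sub>\<beta>(W)\<close>\<close>

text \<open>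
  The free monoid on the letters \<open>0, 1, 2, \<dots>\<close> is written additively, so that the
  convolution product of \<^theory>\<open>HOL-Library.Poly_Mapping\<close> makes finitely supported
  functions on it the free associative algebra.
\<close>

datatype free_word = Word (letters: "nat list")

instantiation free_word :: monoid_add
begin

definition zero_free_word :: free_word where
  "0 = Word []"

definition plus_free_word :: "free_word \<Rightarrow> free_word \<Rightarrow> free_word" where
  "v + w = Word (letters v @ letters w)"

instance
  by standard (simp_all add: zero_free_word_def plus_free_word_def)

end

definition fa_mono :: "nat list \<Rightarrow> free_word \<Rightarrow>\<^sub>0 'a::comm_ring_1" where
  "fa_mono is = Poly_Mapping.single (Word is) 1"

definition fa_const :: "'a \<Rightarrow> free_word \<Rightarrow>\<^sub>0 'a::comm_ring_1" where
  "fa_const c = Poly_Mapping.single 0 c"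

definition free_alg :: "nat \<Rightarrow> (free_word \<Rightarrow>\<^sub>0 'a::comm_ring_1) ring" where
  "free_alg n =
     \<lparr>carrier = {f. \<forall>v \<in> Poly_Mapping.keys f. set (letters v) \<subseteq> {..<n}},
      mult = (*), one = 1, zero = 0, add = (+)\<rparr>"

definition id_relations :: "'a::comm_ring_1 \<Rightarrow> nat \<Rightarrow> (free_word \<Rightarrow>\<^sub>0 'a) set" where
  "id_relations \<beta> n =
     {fa_mono [i, i] - fa_const \<beta> * fa_mono [i] | i. i < n} \<union>
     {fa_mono [i, j] - fa_mono [j, i] | i j. i + 2 \<le> j \<and> j < n} \<union>
     {fa_mono [i, i + 1, i] - fa_mono [i + 1, i, i + 1] | i. 1 \<le> i \<and> i + 1 < n} \<union>
     (if 1 < n then {fa_mono [0, 1, 0, 1] - fa_mono [1, 0, 1, 0]} else {})"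

definition id_ideal :: "'a::comm_ring_1 \<Rightarrow> nat \<Rightarrow> (free_word \<Rightarrow>\<^sub>0 'a) set" where
  "id_ideal \<beta> n = genideal (free_alg n) (id_relations \<beta> n)"

text \<open>
  This is the \<open>\<int>[\<beta>]\<close>-algebra with scalars extended to the coefficient ring \<^typ>\<open>'a\<close>, which
  will contain the variables: as scalars they commute with the generators.
\<close>

definition id_alg :: "'a::comm_ring_1 \<Rightarrow> nat \<Rightarrow> (free_word \<Rightarrow>\<^sub>0 'a) set ring" where
  "id_alg \<beta> n = free_alg n Quot id_ideal \<beta> n"

definition id_class ::
    "'a::comm_ring_1 \<Rightarrow> nat \<Rightarrow> (free_word \<Rightarrow>\<^sub>0 'a) \<Rightarrow> (free_word \<Rightarrow>\<^sub>0 'a) set" where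
  "id_class \<beta> n f = id_ideal \<beta> n +>\<^bsub>free_alg n\<^esub> f"

text \<open>
  The choice of reduced word is immaterial by Matsumoto's theorem.
\<close>

definition u_elem ::
    "'a::comm_ring_1 \<Rightarrow> nat \<Rightarrow> (int \<Rightarrow> int) \<Rightarrow> (free_word \<Rightarrow>\<^sub>0 'a) set" where
  "u_elem \<beta> n w = id_class \<beta> n (fa_mono (SOME is. is_reduced_word n w is))"

text \<open>
  The description below determines the coefficient because the \<open>u\<^sub>w\<close> form a basis.
\<close>

definition u_coeff ::
    "'a::comm_ring_1 \<Rightarrow> nat \<Rightarrow> (free_word \<Rightarrow>\<^sub>0 'a) set \<Rightarrow> (int \<Rightarrow> int) \<Rightarrow> 'a" where
  "u_coeff \<beta> n z w =
     (THE k. \<exists>c. c w = k \<and>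
        z = finsum (id_alg \<beta> n)
              (\<lambda>v. id_class \<beta> n (fa_const (c v)) \<otimes>\<^bsub>id_alg \<beta> n\<^esub> u_elem \<beta> n v)
              (signed_perms n))"


section \<open>Double Grothendieck polynomials\<close>

definition fplus :: "'a::comm_ring_1 \<Rightarrow> 'a \<Rightarrow> 'a \<Rightarrow> 'a" where
  "fplus \<beta> x y = x + y + \<beta> * x * y"

definition fminus :: "'a::field \<Rightarrow> 'a \<Rightarrow> 'a" where
  "fminus \<beta> x = - x / (1 + \<beta> * x)"

definition ring_prod_list :: "('c, 'd) ring_scheme \<Rightarrow> 'c list \<Rightarrow> 'c" where
  "ring_prod_list R zs = foldr (\<lambda>y z. y \<otimes>\<^bsub>R\<^esub> z) zs \<one>\<^bsub>R\<^esub>"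

definition h_elem ::
    "'a::comm_ring_1 \<Rightarrow> nat \<Rightarrow> nat \<Rightarrow> 'a \<Rightarrow> (free_word \<Rightarrow>\<^sub>0 'a) set" where
  "h_elem \<beta> n i x = id_class \<beta> n (1 + fa_const x * fa_mono [i])"

definition A_elem ::
    "'a::comm_ring_1 \<Rightarrow> nat \<Rightarrow> nat \<Rightarrow> 'a \<Rightarrow> (free_word \<Rightarrow>\<^sub>0 'a) set" where
  "A_elem \<beta> n i x =
     ring_prod_list (id_alg \<beta> n) (map (\<lambda>k. h_elem \<beta> n k x) (rev [i..<n]))"

definition G_A ::
    "'a::comm_ring_1 \<Rightarrow> nat \<Rightarrow> (nat \<Rightarrow> 'a) \<Rightarrow> (free_word \<Rightarrow>\<^sub>0 'a) set" where
  "G_A \<beta> n a = ring_prod_list (id_alg \<beta> n) (map (\<lambda>i. A_elem \<beta> n i (a i)) [1..<n])"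

datatype bc_type = TypeB | TypeC

definition F1 ::
    "bc_type \<Rightarrow> 'a::comm_ring_1 \<Rightarrow> nat \<Rightarrow> 'a \<Rightarrow> (free_word \<Rightarrow>\<^sub>0 'a) set" where
  "F1 X \<beta> n x =
     ring_prod_list (id_alg \<beta> n)
       (map (\<lambda>k. h_elem \<beta> n k x)
         (rev [1..<n] @ (case X of TypeB \<Rightarrow> [0] | TypeC \<Rightarrow> [0, 0]) @ [1..<n]))"

definition F_prod ::
    "bc_type \<Rightarrow> 'a::comm_ring_1 \<Rightarrow> nat \<Rightarrow> (nat \<Rightarrow> 'a) \<Rightarrow> (free_word \<Rightarrow>\<^sub>0 'a) set" where
  "F_prod X \<beta> n x =
     ring_prod_list (id_alg \<beta> n) (map (\<lambda>i. F1 X \<beta> n (x i)) [1..<n + 1])"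

definition groth ::
    "bc_type \<Rightarrow> 'a::field \<Rightarrow> nat \<Rightarrow> (int \<Rightarrow> int) \<Rightarrow>
     (nat \<Rightarrow> 'a) \<Rightarrow> (nat \<Rightarrow> 'a) \<Rightarrow> (nat \<Rightarrow> 'a) \<Rightarrow> 'a" where
  "groth X \<beta> n w a b x =
     u_coeff \<beta> n
       (inv\<^bsub>id_alg \<beta> n\<^esub> (G_A \<beta> n (\<lambda>i. fminus \<beta> (b i)))
          \<otimes>\<^bsub>id_alg \<beta> n\<^esub> F_prod X \<beta> n x
          \<otimes>\<^bsub>id_alg \<beta> n\<^esub> G_A \<beta> n a)
       w"


section \<open>Boxes, weights and reduced subsequences\<close>

definition boxes :: "nat \<Rightarrow> (nat \<times> nat) list" where
  "boxes n =
     concat (map (\<lambda>j. map (\<lambda>i. (i, j)) [1..<2 * n - j + 1]) (rev [n + 1..<2 * n])) @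
     concat (map (\<lambda>j. map (\<lambda>i. (i, j)) [n + 1 - j..<2 * n - j + 1]) (rev [1..<n + 1]))"

definition box_refl :: "nat \<Rightarrow> nat \<times> nat \<Rightarrow> nat" where
  "box_refl n = (\<lambda>(i, j). i + j - n - 1)"

definition box_wt ::
    "bc_type \<Rightarrow> 'a::comm_ring_1 \<Rightarrow> nat \<Rightarrow> (nat \<Rightarrow> 'a) \<Rightarrow> (nat \<Rightarrow> 'a) \<Rightarrow> (nat \<Rightarrow> 'a) \<Rightarrow>
     nat \<times> nat \<Rightarrow> 'a" where
  "box_wt X \<beta> n a b x = (\<lambda>(i, j).
     if X = TypeB \<and> i + j = n + 1 then x (n + 1 - i)
     else fplus \<beta> (if i \<le> n then x (n + 1 - i) else a (i - n))
                  (if j \<le> n then x j else b (j - n)))"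

text \<open>
  A subsequence of a word \<open>ds\<close> is represented by its set of positions, counted from \<open>0\<close>;
  \<^term>\<open>nths ds J\<close> is the subsequence itself.
\<close>

definition RSub :: "nat \<Rightarrow> nat list \<Rightarrow> (int \<Rightarrow> int) \<Rightarrow> nat set set" where
  "RSub n ds w =
     {J. J \<subseteq> {..<length ds} \<and> card J = cox_length n w \<and> word_perm (nths ds J) = w}"

definition back_positions :: "nat \<Rightarrow> nat list \<Rightarrow> nat set \<Rightarrow> nat set" where
  "back_positions n ds J =
     {j. j < length ds \<and> j \<notin> J \<and> (\<exists>k\<in>J. k < j) \<and>
         cox_length n (word_perm (nths ds (J \<inter> {..<j})) \<circ> refl_gen (ds ! j))
           < cox_length n (word_perm (nths ds (J \<inter> {..<j})))}"

definition Wt ::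
    "bc_type \<Rightarrow> 'a::comm_ring_1 \<Rightarrow> nat \<Rightarrow> (nat \<Rightarrow> 'a) \<Rightarrow> (nat \<Rightarrow> 'a) \<Rightarrow> (nat \<Rightarrow> 'a) \<Rightarrow>
     nat set \<Rightarrow> 'a" where
  "Wt X \<beta> n a b x J =
     (\<Prod>j\<in>J. box_wt X \<beta> n a b x (boxes n ! j)) *
     (\<Prod>j\<in>back_positions n (map (box_refl n) (boxes n)) J.
        1 + \<beta> * box_wt X \<beta> n a b x (boxes n ! j))"


section \<open>The indeterminates\<close>

text \<open>
  The coefficient field is the fraction field of the polynomial ring over \<open>\<int>\<close> in
  countably many indeterminates, indexed by pairs of natural numbers only because the
  type of multivariate polynomials is an integral domain when its index type is
  linearly ordered.
\<close>

type_synonym coeff = "(((nat \<times> nat) \<Rightarrow>\<^sub>0 nat) \<Rightarrow>\<^sub>0 int) fract"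

definition indet :: "nat \<times> nat \<Rightarrow> coeff" where
  "indet v = Fract (Poly_Mapping.single (Poly_Mapping.single v 1) 1) 1"

definition beta_var :: coeff where "beta_var = indet (0, 0)"
definition a_var :: "nat \<Rightarrow> coeff" where "a_var i = indet (1, i)"
definition b_var :: "nat \<Rightarrow> coeff" where "b_var i = indet (2, i)"
definition x_var :: "nat \<Rightarrow> coeff" where "x_var i = indet (3, i)"

end

theory Submission
  imports Defs
begin

text \<open>
  The algebra acts from the right on functions on signed permutations, with \<open>u\<^sub>i\<close> acting by
  \<open>rho\<close>. Applied to the indicator function of the identity, an element is sent to the function of
  its coefficients in the basis \<open>u\<^sub>w\<close>, so this representation is faithful and both sides can be
  compared as operators.

  The Yang--Baxter relations let \<open>G(b)\<^sup>-\<^sup>1 F(x\<^sub>n) \<dots> F(x\<^sub>1) G(a)\<close> be rewritten as the product of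
  the factors \<open>h\<close> over the boxes: a decreasing factor moves to the left past increasing ones, leaving
  one box in each. The order of the \<open>x\<^sub>i\<close> is immaterial because the \<open>F(x\<^sub>i)\<close> commute.
  Expanding the product over the boxes gives the sum over reduced subwords, since \<open>u\<^sub>v (1 + x u\<^sub>i)\<close> is
  \<open>u\<^sub>v + x u\<^sub>v\<^sub>s\<close> if \<open>s = s\<^sub>i\<close> is an ascent of \<open>v\<close>, and \<open>(1 + \<beta> x) u\<^sub>v\<close> otherwise.
\<close>

section \<open>Descents and length\<close>

text \<open>The coefficient in \<open>u_coeff\<close> is a definite description, so it is meaningful
  only once the \<open>u_elem\<close> are known to span the algebra and to be independent. Spanning
  requires that all reduced words of an element have the same class, hence Matsumoto's theorem;
  independence requires that the quotient does not collapse, which the representation guarantees.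
  Operators are also the place where the exchange relations are computed: the quotient ring is a
  record whose carrier depends on \<open>n\<close>, whereas operators form a type of class
  \<open>monoid_mult\<close>, in which long products can be rewritten freely. Division enters twice,
  in the inverse of \<open>G_A\<close> and in the parameter d with y \<oplus> d = x by which F(x)
  and F(y) are exchanged. Both need 1 + \<beta> z to be nonzero for a variable z. Types B and C
  differ only in the argument of the factor with index 0, which is x or x \<oplus> x. The exchange
  relation of length four is therefore stated for arbitrary arguments subject to one equation, which
  both types satisfy.\<close>

lemma refl_gen_apply:
  "refl_gen i a =
    (if i = 0 then if a = 1 \<or> a = - 1 then - a else a
     else if a = int i then int i + 1
     else if a = int i + 1 then int i
     else if a = - int i then - int i - 1
     else if a = - int i - 1 then - int i else a)"
  by (auto simp: refl_gen_def Transposition.transpose_def)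

lemma refl_gen_invol [simp]: "refl_gen i (refl_gen i a) = a"
  by (auto simp: refl_gen_apply)

lemma comp_refl_gen_twice [simp]: "v \<circ> refl_gen i \<circ> refl_gen i = v"
  by (simp add: fun_eq_iff)

lemma refl_gen_minus: "refl_gen i (- a) = - refl_gen i a"
  by (auto simp: refl_gen_apply)

lemma refl_gen_permutes: "i < n \<Longrightarrow> refl_gen i permutes ({- int n..int n} - {0})"
  by (intro bij_imp_permutes bij_betw_byWitness[where f' = "refl_gen i"])
    (auto simp: refl_gen_apply)

lemma refl_gen_signed_perms: "i < n \<Longrightarrow> refl_gen i \<in> signed_perms n"
  by (simp add: signed_perms_def refl_gen_permutes refl_gen_minus)

lemma id_signed_perms [simp]: "id \<in> signed_perms n"
  by (simp add: signed_perms_def permutes_id)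

lemma comp_signed_perms: "v \<in> signed_perms n \<Longrightarrow> w \<in> signed_perms n \<Longrightarrow> v \<circ> w \<in> signed_perms n"
  by (simp add: signed_perms_def permutes_compose)

lemma comp_refl_gen_signed_perms [simp]:
  assumes "i < n"
  shows "v \<circ> refl_gen i \<in> signed_perms n \<longleftrightarrow> v \<in> signed_perms n"
  using comp_signed_perms[OF _ refl_gen_signed_perms[OF assms], of v]
    comp_signed_perms[OF _ refl_gen_signed_perms[OF assms], of "v \<circ> refl_gen i"]
  by (auto simp del: o_apply)

lemma finite_signed_perms: "finite (signed_perms n)"
  using finite_permutations[of "{- int n..int n} - {0}"]
  by (rule rev_finite_subset) (auto simp: signed_perms_def)

lemma signed_perms_minus: "v \<in> signed_perms n \<Longrightarrow> v (- a) = - v a"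
  by (simp add: signed_perms_def)

lemma signed_perms_inj: "v \<in> signed_perms n \<Longrightarrow> v a = v b \<longleftrightarrow> a = b"
  using permutes_inj[of v] by (auto simp: signed_perms_def dest: injD)

lemma signed_perms_eq_0: "v \<in> signed_perms n \<Longrightarrow> v a = 0 \<longleftrightarrow> a = 0"
  using signed_perms_minus[of v n 0] signed_perms_inj[of v n a 0] by auto

lemma signed_perms_range: "v \<in> signed_perms n \<Longrightarrow> a \<in> {- int n..int n} \<Longrightarrow> v a \<in> {- int n..int n}"
  using permutes_in_image[of v "{- int n..int n} - {0}" a] signed_perms_eq_0[of v n a]
  by (cases "a = 0") (auto simp: signed_perms_def)

section \<open>Words in the generators\<close>

lemma word_perm_Nil [simp]: "word_perm [] = id"
  by (simp add: word_perm_def)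

lemma word_perm_Cons [simp]: "word_perm (i # is) = refl_gen i \<circ> word_perm is"
  by (simp add: word_perm_def)

lemma word_perm_append [simp]: "word_perm (is @ js) = word_perm is \<circ> word_perm js"
  by (induction "is") (auto simp: o_assoc)

lemma word_perm_snoc: "word_perm (is @ [i]) = word_perm is \<circ> refl_gen i"
  by simp

lemma word_perm_signed_perms: "set is \<subseteq> {..<n} \<Longrightarrow> word_perm is \<in> signed_perms n"
  by (induction "is") (auto intro: comp_signed_perms refl_gen_signed_perms)

text \<open>Right descents in one-line notation. As v is odd, the case \<open>i = 0\<close> compares
  v(-1) with v(1).\<close>

definition des :: "nat \<Rightarrow> (int \<Rightarrow> int) \<Rightarrow> bool" where
  "des i v \<longleftrightarrow> (if i = 0 then v 1 < 0 else v (int i) > v (int i + 1))"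

lemma des_comp_refl_gen:
  assumes "v \<in> signed_perms n"
  shows "des i (v \<circ> refl_gen i) \<longleftrightarrow> \<not> des i v"
  using signed_perms_minus[OF assms, of 1] signed_perms_eq_0[OF assms, of 1]
    signed_perms_inj[OF assms, of "int i" "int i + 1"]
  by (auto simp: des_def refl_gen_apply)

text \<open>
  An inversion \<open>(a, b)\<close> comes together with the inversion \<open>(- b, - a)\<close>, and the two coincide
  exactly for \<open>a = - b\<close>. Counting sign changes once more makes the statistic twice the length.
\<close>

definition inversions :: "nat \<Rightarrow> (int \<Rightarrow> int) \<Rightarrow> (int \<times> int) set" where
  "inversions n v =
     {(a, b). a \<in> {- int n..int n} - {0} \<and> b \<in> {- int n..int n} - {0} \<and> a < b \<and> v b < v a}"

definition sign_changes :: "nat \<Rightarrow> (int \<Rightarrow> int) \<Rightarrow> int set" where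
  "sign_changes n v = {a. 0 < a \<and> a \<le> int n \<and> v a < 0}"

definition inv_stat :: "nat \<Rightarrow> (int \<Rightarrow> int) \<Rightarrow> nat" where
  "inv_stat n v = card (inversions n v) + card (sign_changes n v)"

lemma finite_inversions: "finite (inversions n v)"
  by (rule finite_subset[of _ "{- int n..int n} \<times> {- int n..int n}"]) (auto simp: inversions_def)

lemma finite_sign_changes: "finite (sign_changes n v)"
  by (rule finite_subset[of _ "{- int n..int n}"]) (auto simp: sign_changes_def)

text \<open>Composing with a generator relabels the positions of inversions. It is monotone except
  on the pairs that it swaps, and at a descent exactly these inversions disappear: one pair for
  \<open>i = 0\<close>, two mirror pairs otherwise. The sign changes supply the missing one, so the
  loss is 2 in both cases.\<close>

lemma inv_stat_descent:
  assumes v: "v \<in> signed_perms n" and i: "i < n" and d: "des i v"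
  shows "inv_stat n v = inv_stat n (v \<circ> refl_gen i) + 2"
proof -
  define s where "s = refl_gen i"
  define Sp where "Sp = (if i = 0 then {(-1, 1)} else {(int i, int i + 1), (- int i - 1, - int i)})"
  have vm: "v (- int i - 1) = - v (int i + 1)" "v (- int i) = - v (int i)" "v (- 1) = - v 1"
    using signed_perms_minus[OF v, of "int i + 1"] signed_perms_minus[OF v, of "int i"]
      signed_perms_minus[OF v, of 1] by simp_all
  have D: "s a \<in> {- int n..int n} - {0} \<longleftrightarrow> a \<in> {- int n..int n} - {0}" for a
    using permutes_in_image[OF refl_gen_permutes[OF i]] by (simp add: s_def)
  \<comment> \<open>Zero has to be left out: \<open>refl_gen 0\<close> reverses the pair (-1,
    0).\<close>
  have mono: "s a < s b" if "a < b" "(a, b) \<notin> Sp" "a \<noteq> 0" "b \<noteq> 0" for a b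
    using that unfolding s_def refl_gen_apply Sp_def by (cases "i = 0") (auto; fail)+
  have ss: "s (s a) = a" for a
    by (simp add: s_def)
  have "s b < s a" if "(a, b) \<in> Sp" for a b
    using that by (auto simp: s_def refl_gen_apply Sp_def split: if_splits)
  then have sSp: "(s a, s b) \<notin> Sp" if "a < b" for a b
    using that ss[of a] ss[of b] by force
  have sub: "Sp \<subseteq> inversions n v"
    using d i vm by (auto simp: Sp_def inversions_def des_def split: if_splits)
  have dis: "(a, b) \<notin> Sp" if "(a, b) \<in> inversions n (v \<circ> s)" for a b
    using that d i vm
    by (auto simp: Sp_def inversions_def des_def s_def refl_gen_apply split: if_splits)
  have "bij_betw (\<lambda>(a, b). (s a, s b)) (inversions n v - Sp) (inversions n (v \<circ> s))"
  proof (rule bij_betw_byWitness[where f' = "\<lambda>(a, b). (s a, s b)"])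
    show "(\<lambda>(a, b). (s a, s b)) ` (inversions n v - Sp) \<subseteq> inversions n (v \<circ> s)"
      using D mono ss by (fastforce simp: inversions_def)
    show "(\<lambda>(a, b). (s a, s b)) ` inversions n (v \<circ> s) \<subseteq> inversions n v - Sp"
      using D mono dis sSp by (fastforce simp: inversions_def)
  qed (auto simp: ss)
  then have c1: "card (inversions n v) = card (inversions n (v \<circ> s)) + card Sp"
    using bij_betw_same_card card_Diff_subset[OF finite_subset[OF sub finite_inversions] sub]
      card_mono[OF finite_inversions sub] by fastforce
  have c2: "card (sign_changes n v) + card Sp = card (sign_changes n (v \<circ> s)) + 2"
  proof (cases "i = 0")
    case True
    have "sign_changes n v = insert 1 (sign_changes n (v \<circ> s))" "1 \<notin> sign_changes n (v \<circ> s)"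
      using True d i vm(3)
      by (auto simp: sign_changes_def des_def s_def refl_gen_apply split: if_splits)
    then show ?thesis
      using True finite_sign_changes[of n "v \<circ> s"] by (simp add: Sp_def)
  next
    case False
    have pos: "0 < s a \<longleftrightarrow> 0 < a" and le: "s a \<le> int n \<longleftrightarrow> a \<le> int n" for a
      using False i by (auto simp: s_def refl_gen_apply)
    have "bij_betw s (sign_changes n v) (sign_changes n (v \<circ> s))"
      by (rule bij_betw_byWitness[where f' = s]) (auto simp: sign_changes_def ss pos le)
    then show ?thesis
      using False by (simp add: bij_betw_same_card Sp_def)
  qed
  show ?thesis
    using c1 c2 by (simp add: inv_stat_def s_def)
qed

lemma inv_stat_ascent:
  assumes "v \<in> signed_perms n" "i < n" "\<not> des i v"
  shows "inv_stat n (v \<circ> refl_gen i) = inv_stat n v + 2"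
  using inv_stat_descent[of "v \<circ> refl_gen i" n i] des_comp_refl_gen[OF assms(1), of i] assms
  by simp

lemma inv_stat_id [simp]: "inv_stat n id = 0"
  by (simp add: inv_stat_def inversions_def sign_changes_def case_prod_unfold)
    (auto simp: card_eq_0_iff)

text \<open>Without descents 0 < v(1) < ... < v(n) \<le> n, which leaves no choice: climbing from 1
  gives v(k) \<ge> k, going down from n gives v(k) \<le> k.\<close>

lemma no_descent_imp_id:
  assumes v: "v \<in> signed_perms n" and nd: "\<And>i. i < n \<Longrightarrow> \<not> des i v"
  shows "v = id"
proof -
  have low: "int k + 1 \<le> v (int k + 1)" if "k < n" for k
    using that
  proof (induction k)
    case 0
    then show ?case
      using nd[of 0] signed_perms_eq_0[OF v, of 1] by (simp add: des_def)
  next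
    case (Suc k)
    then have "v (int k + 1) \<le> v (int (Suc k) + 1)"
      using nd[of "Suc k"] by (simp add: des_def add.commute)
    moreover have "v (int k + 1) \<noteq> v (int (Suc k) + 1)"
      by (simp add: signed_perms_inj[OF v])
    ultimately show ?case
      using Suc by simp
  qed
  have up: "v (int (n - k)) \<le> int (n - k)" if "k < n" for k
    using that
  proof (induction k)
    case 0
    then show ?case
      using signed_perms_range[OF v, of "int n"] by simp
  next
    case (Suc k)
    have eq: "int (n - Suc k) + 1 = int (n - k)" and pos: "n - Suc k \<noteq> 0" "n - Suc k < n"
      using Suc.prems by auto
    have "v (int (n - Suc k)) \<le> v (int (n - k))"
      using nd[of "n - Suc k"] pos unfolding des_def eq by simp
    moreover have "v (int (n - Suc k)) \<noteq> v (int (n - k))"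
      using eq by (simp add: signed_perms_inj[OF v])
    ultimately show ?case
      using Suc eq by simp
  qed
  have pos: "v a = a" if "0 < a" "a \<le> int n" for a
  proof -
    have "a = int (nat a - 1) + 1" "nat a - 1 < n" "a = int (n - (n - nat a))" "n - nat a < n"
      using that by auto
    then show ?thesis
      using low[of "nat a - 1"] up[of "n - nat a"] by (metis order_antisym)
  qed
  have out: "v a = a" if "a \<notin> {- int n..int n} - {0}" for a
    using v that by (auto simp: signed_perms_def permutes_def)
  have "v a = a" for a
    using pos[of a] pos[of "- a"] out[of a] signed_perms_minus[OF v, of a]
    by (cases "0 < a \<and> a \<le> int n"; cases "0 < - a \<and> - a \<le> int n") auto
  then show ?thesis
    by (simp add: fun_eq_iff)
qed

text \<open>Stripping right descents lowers the statistic by 2 per letter and can only stop at the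
  identity.\<close>

lemma ex_word_inv_stat:
  assumes "v \<in> signed_perms n"
  shows "\<exists>is. set is \<subseteq> {..<n} \<and> word_perm is = v \<and> 2 * length is = inv_stat n v"
  using assms
proof (induction "inv_stat n v" arbitrary: v rule: less_induct)
  case less
  show ?case
  proof (cases "\<exists>i<n. des i v")
    case True
    then obtain i where i: "i < n" "des i v" by blast
    then obtain "is" where "set is \<subseteq> {..<n}" "word_perm is = v \<circ> refl_gen i"
      "2 * length is = inv_stat n (v \<circ> refl_gen i)"
      using less.hyps[of "v \<circ> refl_gen i"] less.prems inv_stat_descent[OF less.prems i] by auto
    then show ?thesis
      using i inv_stat_descent[OF less.prems i]
      by (intro exI[of _ "is @ [i]"]) auto
  next
    case False
    then have "v = id"
      using no_descent_imp_id[OF less.prems] by blast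
    then show ?thesis
      by (intro exI[of _ "[]"]) simp
  qed
qed

text \<open>Each letter raises the statistic by at most 2, so half of it is a lower bound for the
  length of any word; the word found above attains it.\<close>

lemma inv_stat_word_perm_le: "set is \<subseteq> {..<n} \<Longrightarrow> inv_stat n (word_perm is) \<le> 2 * length is"
proof (induction "is" rule: rev_induct)
  case (snoc i "is")
  then have *: "inv_stat n (word_perm is \<circ> refl_gen i) \<le> 2 * length is + 2"
    using inv_stat_descent[of "word_perm is" n i] inv_stat_ascent[of "word_perm is" n i]
      word_perm_signed_perms[of "is" n]
    by (cases "des i (word_perm is)") simp_all
  have "inv_stat n (word_perm (is @ [i])) = inv_stat n (word_perm is \<circ> refl_gen i)"
    by (rule arg_cong[OF word_perm_snoc])
  with * show ?case
    by (simp del: word_perm_append)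
qed simp

lemma double_cox_length:
  assumes "v \<in> signed_perms n"
  shows "2 * cox_length n v = inv_stat n v"
proof -
  obtain js where js: "set js \<subseteq> {..<n}" "word_perm js = v" "2 * length js = inv_stat n v"
    using ex_word_inv_stat[OF assms] by blast
  have "cox_length n v = length js"
    unfolding cox_length_def
  proof (rule Least_equality)
    show "\<exists>is. set is \<subseteq> {..<n} \<and> length is = length js \<and> word_perm is = v"
      using js by blast
    fix l assume "\<exists>is. set is \<subseteq> {..<n} \<and> length is = l \<and> word_perm is = v"
    then obtain ks where "set ks \<subseteq> {..<n}" "length ks = l" "word_perm ks = v"
      by blast
    then show "length js \<le> l"
      using inv_stat_word_perm_le[of ks n] js(3) by simp
  qed
  then show ?thesis
    using js(3) by simp
qed

lemma cox_length_id [simp]: "cox_length n id = 0"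
  using double_cox_length[of id n] by simp

lemma cox_length_descent:
  assumes "v \<in> signed_perms n" "i < n" "des i v"
  shows "cox_length n v = Suc (cox_length n (v \<circ> refl_gen i))"
  using double_cox_length[of v n] double_cox_length[of "v \<circ> refl_gen i" n] inv_stat_descent[OF assms]
    assms by simp

lemma cox_length_ascent:
  assumes "v \<in> signed_perms n" "i < n" "\<not> des i v"
  shows "cox_length n (v \<circ> refl_gen i) = Suc (cox_length n v)"
  using double_cox_length[of v n] double_cox_length[of "v \<circ> refl_gen i" n] inv_stat_ascent[OF assms]
    assms by simp

lemma cox_length_comp_less_iff:
  assumes "v \<in> signed_perms n" "i < n"
  shows "cox_length n (v \<circ> refl_gen i) < cox_length n v \<longleftrightarrow> des i v"
  using cox_length_descent[OF assms] cox_length_ascent[OF assms] by fastforce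

lemma ex_reduced_word:
  assumes "v \<in> signed_perms n"
  shows "\<exists>is. is_reduced_word n v is"
  using ex_word_inv_stat[OF assms] double_cox_length[OF assms]
  by (fastforce simp: is_reduced_word_def)

lemma cox_length_le_length: "set is \<subseteq> {..<n} \<Longrightarrow> cox_length n (word_perm is) \<le> length is"
  using inv_stat_word_perm_le[of "is" n] double_cox_length[of "word_perm is" n] word_perm_signed_perms
  by fastforce

lemma reduced_word_signed_perms: "is_reduced_word n v is \<Longrightarrow> v \<in> signed_perms n"
  using word_perm_signed_perms by (auto simp: is_reduced_word_def)

text \<open>The prefix bounds the length of v s_i from above, which forces the last letter to be a
  descent. Inductions on reduced words run through this equivalence.\<close>

lemma reduced_word_snoc_iff:
  "is_reduced_word n v (is @ [i]) \<longleftrightarrow>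
     i < n \<and> v \<in> signed_perms n \<and> des i v \<and> is_reduced_word n (v \<circ> refl_gen i) is"
  (is "?L \<longleftrightarrow> ?R")
proof
  assume L: ?L
  then have i: "i < n" and s: "set is \<subseteq> {..<n}" and w: "word_perm is \<circ> refl_gen i = v"
    and l: "Suc (length is) = cox_length n v"
    by (auto simp: is_reduced_word_def)
  have v: "v \<in> signed_perms n"
    using L by (rule reduced_word_signed_perms)
  have u: "word_perm is = v \<circ> refl_gen i"
    using w by auto
  have "des i v"
    using cox_length_le_length[OF s] cox_length_comp_less_iff[OF v i] l u by simp
  then show ?R
    using i v s u l cox_length_descent[OF v i] by (simp add: is_reduced_word_def)
next
  assume ?R
  then show ?L
    using cox_length_descent[of v n i] by (auto simp: is_reduced_word_def)
qed

section \<open>The quotient algebra\<close>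

lemma carrier_free_alg:
  "f \<in> carrier (free_alg n) \<longleftrightarrow> (\<forall>v \<in> Poly_Mapping.keys f. set (letters v) \<subseteq> {..<n})"
  by (simp add: free_alg_def)

lemma free_alg_simps [simp]:
  "x \<otimes>\<^bsub>free_alg n\<^esub> y = x * y" "x \<oplus>\<^bsub>free_alg n\<^esub> y = x + y"
  "\<one>\<^bsub>free_alg n\<^esub> = 1" "\<zero>\<^bsub>free_alg n\<^esub> = 0"
  by (simp_all add: free_alg_def)

lemma one_carrier [simp]: "1 \<in> carrier (free_alg n)"
  by (simp add: carrier_free_alg zero_free_word_def)

lemma zero_carrier [simp]: "0 \<in> carrier (free_alg n)"
  by (simp add: carrier_free_alg)

lemma add_carrier [simp]:
  "f \<in> carrier (free_alg n) \<Longrightarrow> g \<in> carrier (free_alg n) \<Longrightarrow> f + g \<in> carrier (free_alg n)"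
  using Poly_Mapping.keys_add[of f g] by (auto simp: carrier_free_alg)

lemma uminus_carrier [simp]:
  "f \<in> carrier (free_alg n) \<Longrightarrow> - f \<in> carrier (free_alg n)"
  by (auto simp: carrier_free_alg in_keys_iff)

lemma diff_carrier [simp]:
  "f \<in> carrier (free_alg n) \<Longrightarrow> g \<in> carrier (free_alg n) \<Longrightarrow> f - g \<in> carrier (free_alg n)"
  using add_carrier[of f n "- g"] by simp

lemma mult_carrier [simp]:
  "f \<in> carrier (free_alg n) \<Longrightarrow> g \<in> carrier (free_alg n) \<Longrightarrow> f * g \<in> carrier (free_alg n)"
  using Poly_Mapping.keys_mult[of f g] by (fastforce simp: carrier_free_alg plus_free_word_def)

lemma sum_carrier [simp]:
  "(\<And>x. x \<in> A \<Longrightarrow> f x \<in> carrier (free_alg n)) \<Longrightarrow> sum f A \<in> carrier (free_alg n)"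
  by (induction A rule: infinite_finite_induct) simp_all

lemma fa_const_carrier [simp]: "fa_const c \<in> carrier (free_alg n)"
  by (auto simp: carrier_free_alg fa_const_def zero_free_word_def)

lemma fa_mono_carrier [simp]: "fa_mono is \<in> carrier (free_alg n)" if "set is \<subseteq> {..<n}"
  using that by (auto simp: carrier_free_alg fa_mono_def)

lemma fa_mono_Nil [simp]: "fa_mono [] = 1"
  by (simp add: fa_mono_def flip: zero_free_word_def)

lemma fa_mono_append: "fa_mono (is @ js) = fa_mono is * fa_mono js"
  by (simp add: fa_mono_def mult_single plus_free_word_def)

lemma fa_const_0 [simp]: "fa_const 0 = 0"
  by (simp add: fa_const_def)

lemma fa_const_1 [simp]: "fa_const 1 = 1"
  by (simp add: fa_const_def)

lemma fa_const_add: "fa_const (c + d) = fa_const c + fa_const d"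
  by (simp add: fa_const_def single_add)

lemma fa_const_mult: "fa_const (c * d) = fa_const c * fa_const d"
  by (simp add: fa_const_def mult_single)

lemma poly_mapping_eq_sum_single:
  fixes p :: "'a \<Rightarrow>\<^sub>0 'b::comm_monoid_add"
  shows
  "p = (\<Sum>v\<in>Poly_Mapping.keys p. Poly_Mapping.single v (Poly_Mapping.lookup p v))"
  by (rule poly_mapping_eqI) (auto simp: lookup_sum lookup_single when_def not_in_keys_iff_lookup_eq_zero)

text \<open>Reduces identities that are additive in \<open>p\<close> to single terms.\<close>

lemma poly_mapping_add_induct [case_names zero single add]:
  fixes p :: "'a \<Rightarrow>\<^sub>0 'b::comm_monoid_add"
  assumes "P 0" "\<And>v c. P (Poly_Mapping.single v c)" "\<And>p q. P p \<Longrightarrow> P q \<Longrightarrow> P (p + q)"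
  shows "P p"
proof -
  have "P (\<Sum>v\<in>A. Poly_Mapping.single v (Poly_Mapping.lookup p v))" for A
    by (induction A rule: infinite_finite_induct) (auto intro: assms)
  then show ?thesis
    by (subst poly_mapping_eq_sum_single)
qed

lemma fa_const_commute: "p * fa_const c = fa_const c * (p :: free_word \<Rightarrow>\<^sub>0 'a::comm_ring_1)"
proof (induction p rule: poly_mapping_add_induct)
  case (single v d)
  then show ?case
    by (simp add: fa_const_def mult_single mult.commute)
qed (simp_all add: distrib_left distrib_right)

lemma single_eq_const_mono: "Poly_Mapping.single v c = fa_const c * fa_mono (letters v)"
  by (simp add: fa_const_def fa_mono_def mult_single)

lemma ring_free_alg: "ring (free_alg n)"
proof (rule ringI)
  show "abelian_group (free_alg n)"
    by (rule abelian_groupI) (auto intro!: bexI[of _ "- x" for x] simp: algebra_simps)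
  show "monoid (free_alg n)"
    by (rule monoidI) (auto simp: algebra_simps)
qed (auto simp: algebra_simps)

lemma free_alg_minus [simp]:
  assumes "f \<in> carrier (free_alg n)" "g \<in> carrier (free_alg n)"
  shows "f \<ominus>\<^bsub>free_alg n\<^esub> g = f - g"
proof -
  interpret R: ring "free_alg n" by (rule ring_free_alg)
  have "\<ominus>\<^bsub>free_alg n\<^esub> g = - g"
    using assms by (intro R.minus_equality) auto
  then show ?thesis
    by (simp add: a_minus_def)
qed

section \<open>The defining ideal and its quotient\<close>

lemma id_relations_carrier: "id_relations \<beta> n \<subseteq> carrier (free_alg n)"
  by (auto simp: id_relations_def intro!: diff_carrier mult_carrier fa_mono_carrier)

lemma ideal_id_ideal: "ideal (id_ideal \<beta> n) (free_alg n)"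
  unfolding id_ideal_def by (rule ring.genideal_ideal[OF ring_free_alg id_relations_carrier])

lemma id_relations_subset: "id_relations \<beta> n \<subseteq> id_ideal \<beta> n"
  unfolding id_ideal_def by (rule ring.genideal_self[OF ring_free_alg id_relations_carrier])

lemma ring_id_alg: "ring (id_alg \<beta> n)"
  unfolding id_alg_def by (rule ideal.quotient_is_ring[OF ideal_id_ideal])

lemma id_class_hom: "id_class \<beta> n \<in> ring_hom (free_alg n) (id_alg \<beta> n)"
proof -
  have "id_class \<beta> n = (+>\<^bsub>free_alg n\<^esub>) (id_ideal \<beta> n)"
    by (simp add: fun_eq_iff id_class_def)
  then show ?thesis
    unfolding id_alg_def using ideal.rcos_ring_hom[OF ideal_id_ideal] by simp
qed

lemmas id_class_closed [simp] = ring_hom_closed[OF id_class_hom]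
lemmas id_class_mult = ring_hom_mult[OF id_class_hom, simplified free_alg_simps]
lemmas id_class_add = ring_hom_add[OF id_class_hom, simplified free_alg_simps]
lemmas id_class_one = ring_hom_one[OF id_class_hom, simplified free_alg_simps]

lemma id_class_eq_iff:
  assumes "p \<in> carrier (free_alg n)" "q \<in> carrier (free_alg n)"
  shows "id_class \<beta> n p = id_class \<beta> n q \<longleftrightarrow> p - q \<in> id_ideal \<beta> n"
  using ring.quotient_eq_iff_same_a_r_cos[OF ring_free_alg ideal_id_ideal assms] assms
  by (simp add: id_class_def)

lemma id_class_sum:
  assumes "finite A" "\<And>v. v \<in> A \<Longrightarrow> f v \<in> carrier (free_alg n)"
  shows "id_class \<beta> n (sum f A) = finsum (id_alg \<beta> n) (\<lambda>v. id_class \<beta> n (f v)) A"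
proof -
  interpret Q: ring "id_alg \<beta> n" by (rule ring_id_alg)
  interpret R: ring "free_alg n" by (rule ring_free_alg)
  show ?thesis
    using assms
  proof (induction A rule: finite_induct)
    case empty
    show ?case
      using ring_hom_zero[OF id_class_hom ring_free_alg ring_id_alg] by simp
  next
    case (insert x A)
    then have "id_class \<beta> n (sum f (insert x A)) =
        id_class \<beta> n (f x) \<oplus>\<^bsub>id_alg \<beta> n\<^esub> finsum (id_alg \<beta> n) (\<lambda>v. id_class \<beta> n (f v)) A"
      by (simp add: id_class_add)
    also have "\<dots> = finsum (id_alg \<beta> n) (\<lambda>v. id_class \<beta> n (f v)) (insert x A)"
      using insert by (intro Q.finsum_insert[symmetric]) auto
    finally show ?case .
  qed
qed

lemma ring_prod_list_id_class:
  assumes "\<And>p. p \<in> set ps \<Longrightarrow> p \<in> carrier (free_alg n)"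
  shows "ring_prod_list (id_alg \<beta> n) (map (id_class \<beta> n) ps) = id_class \<beta> n (prod_list ps)"
    and "prod_list ps \<in> carrier (free_alg n)"
  using assms by (induction ps) (simp_all add: ring_prod_list_def id_class_one id_class_mult)

text \<open>Equality of classes, kept on representatives: congruences can be chained in the free
  algebra with its type class operations instead of in the ring of cosets.\<close>

definition id_eq ::
    "'a::comm_ring_1 \<Rightarrow> nat \<Rightarrow> (free_word \<Rightarrow>\<^sub>0 'a) \<Rightarrow> (free_word \<Rightarrow>\<^sub>0 'a) \<Rightarrow> bool" where
  "id_eq \<beta> n p q \<longleftrightarrow> p - q \<in> id_ideal \<beta> n"

lemma id_eq_refl [simp]: "id_eq \<beta> n p p"
  using additive_subgroup.zero_closed[OF ideal.axioms(1)[OF ideal_id_ideal]]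
  by (simp add: id_eq_def)

lemma id_eq_add: "id_eq \<beta> n p q \<Longrightarrow> id_eq \<beta> n p' q' \<Longrightarrow> id_eq \<beta> n (p + p') (q + q')"
  using additive_subgroup.a_closed[OF ideal.axioms(1)[OF ideal_id_ideal]]
  unfolding id_eq_def by (fastforce simp: algebra_simps)

lemma id_eq_mult_left: "id_eq \<beta> n p q \<Longrightarrow> r \<in> carrier (free_alg n) \<Longrightarrow> id_eq \<beta> n (r * p) (r * q)"
  using ideal.I_l_closed[OF ideal_id_ideal, of "p - q" \<beta> n r] by (simp add: id_eq_def algebra_simps)

lemma id_eq_mult_right: "id_eq \<beta> n p q \<Longrightarrow> r \<in> carrier (free_alg n) \<Longrightarrow> id_eq \<beta> n (p * r) (q * r)"
  using ideal.I_r_closed[OF ideal_id_ideal, of "p - q" \<beta> n r] by (simp add: id_eq_def algebra_simps)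

lemma id_eq_sym: "id_eq \<beta> n p q \<Longrightarrow> id_eq \<beta> n q p"
  \<comment> \<open>Multiplying by -1 and adding p + q turns the congruence around.\<close>
  using id_eq_mult_left[of \<beta> n p q "-1"] id_eq_add[of \<beta> n "- p" "- q" "p + q" "p + q"] by simp

lemma id_eq_trans [trans]: "id_eq \<beta> n p q \<Longrightarrow> id_eq \<beta> n q r \<Longrightarrow> id_eq \<beta> n p r"
  using id_eq_add[of \<beta> n p q q r] by (simp add: id_eq_def)

lemma id_eq_sum: "(\<And>v. v \<in> A \<Longrightarrow> id_eq \<beta> n (f v) (g v)) \<Longrightarrow> id_eq \<beta> n (sum f A) (sum g A)"
  by (induction A rule: infinite_finite_induct) (auto intro: id_eq_add)

lemma id_eq_quadratic: "i < n \<Longrightarrow> id_eq \<beta> n (fa_mono [i, i]) (fa_const \<beta> * fa_mono [i])"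
  using id_relations_subset[of \<beta> n] unfolding id_eq_def id_relations_def by blast

lemma id_eq_commute: "i + 2 \<le> j \<Longrightarrow> j < n \<Longrightarrow> id_eq \<beta> n (fa_mono [i, j]) (fa_mono [j, i])"
  using id_relations_subset[of \<beta> n] unfolding id_eq_def id_relations_def by blast

lemma id_eq_braid3:
  "1 \<le> i \<Longrightarrow> i + 1 < n \<Longrightarrow> id_eq \<beta> n (fa_mono [i, i + 1, i]) (fa_mono [i + 1, i, i + 1])"
  using id_relations_subset[of \<beta> n] unfolding id_eq_def id_relations_def by blast

lemma id_eq_braid4: "1 < n \<Longrightarrow> id_eq \<beta> n (fa_mono [0, 1, 0, 1]) (fa_mono [1, 0, 1, 0])"
  using id_relations_subset[of \<beta> n] unfolding id_eq_def id_relations_def by auto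

section \<open>The regular representation\<close>

lemma des_far:
  "i + 2 \<le> j \<Longrightarrow> des j (v \<circ> refl_gen i) \<longleftrightarrow> des j v"
  "i + 2 \<le> j \<Longrightarrow> des i (v \<circ> refl_gen j) \<longleftrightarrow> des i v"
  by (auto simp: des_def refl_gen_apply)

lemma refl_gen_commute: "i + 2 \<le> j \<Longrightarrow> refl_gen i \<circ> refl_gen j = refl_gen j \<circ> refl_gen i"
  by (auto simp: fun_eq_iff refl_gen_apply)

lemma refl_gen_braid3:
  assumes "1 \<le> i"
  shows "refl_gen i \<circ> refl_gen (i + 1) \<circ> refl_gen i = refl_gen (i + 1) \<circ> refl_gen i \<circ> refl_gen (i + 1)"
  using assms unfolding fun_eq_iff by (simp add: refl_gen_apply)

lemma refl_gen_braid4: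
  "refl_gen 0 \<circ> refl_gen 1 \<circ> refl_gen 0 \<circ> refl_gen 1 = refl_gen 1 \<circ> refl_gen 0 \<circ> refl_gen 1 \<circ> refl_gen 0"
  unfolding fun_eq_iff by (simp add: refl_gen_apply)

text \<open>Every descent met along the two sides of the braid relation is one of the three
  comparisons between v(i), v(i + 1) and v(i + 2).\<close>

lemma des_braid3:
  assumes "1 \<le> i"
  shows "des i (v \<circ> refl_gen (i + 1)) \<longleftrightarrow> v (int i) > v (int i + 2)"
    "des (i + 1) (v \<circ> refl_gen i) \<longleftrightarrow> v (int i) > v (int i + 2)"
    "des i (v \<circ> refl_gen i \<circ> refl_gen (i + 1)) \<longleftrightarrow> des (i + 1) v"
    "des (i + 1) (v \<circ> refl_gen (i + 1) \<circ> refl_gen i) \<longleftrightarrow> des i v"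
  using assms by (auto simp: des_def refl_gen_apply ac_simps)

text \<open>The descents met here are decided by v(1), v(2), v(1) - v(2) and v(1) + v(2); the sum
  appears because \<open>refl_gen 0\<close> negates v(1).\<close>

lemma des_braid4:
  assumes "v \<in> signed_perms n"
  shows "des 1 (v \<circ> refl_gen 0) \<longleftrightarrow> v 1 + v 2 < 0"
    "des 0 (v \<circ> refl_gen 1) \<longleftrightarrow> v 2 < 0"
    "des 0 (v \<circ> refl_gen 0 \<circ> refl_gen 1) \<longleftrightarrow> v 2 < 0"
    "des 1 (v \<circ> refl_gen 1 \<circ> refl_gen 0) \<longleftrightarrow> v 1 + v 2 < 0"
    "des 1 (v \<circ> refl_gen 0 \<circ> refl_gen 1 \<circ> refl_gen 0) \<longleftrightarrow> des 1 v"
    "des 0 (v \<circ> refl_gen 1 \<circ> refl_gen 0 \<circ> refl_gen 1) \<longleftrightarrow> des 0 v"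
  using signed_perms_minus[OF assms, of 1] signed_perms_minus[OF assms, of 2]
  by (auto simp: des_def refl_gen_apply)

text \<open>Right multiplication of the sum of f(v) u_v by u_i, written on coefficients. At a
  descent v, with s = s_i, the term of v contributes \<beta> f(v) and the term of vs contributes
  f(vs); elements for which i is an ascent do not occur in the result.\<close>

definition rho :: "'a::comm_ring_1 \<Rightarrow> nat \<Rightarrow> nat \<Rightarrow> ((int \<Rightarrow> int) \<Rightarrow> 'a) \<Rightarrow> (int \<Rightarrow> int) \<Rightarrow> 'a" where
  "rho \<beta> n i f v = (if v \<in> signed_perms n \<and> des i v then \<beta> * f v + f (v \<circ> refl_gen i) else 0)"

lemma rho_add: "rho \<beta> n i (\<lambda>v. f v + g v) = (\<lambda>v. rho \<beta> n i f v + rho \<beta> n i g v)"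
  by (auto simp: fun_eq_iff rho_def algebra_simps)

lemma rho_scale: "rho \<beta> n i (\<lambda>v. c * f v) = (\<lambda>v. c * rho \<beta> n i f v)"
  by (auto simp: fun_eq_iff rho_def algebra_simps)

lemma rho_quadratic:
  assumes "i < n"
  shows "rho \<beta> n i (rho \<beta> n i f) = (\<lambda>v. \<beta> * rho \<beta> n i f v)"
  using assms by (auto simp: fun_eq_iff rho_def des_comp_refl_gen)

lemma rho_commute:
  assumes "i + 2 \<le> j" "j < n"
  shows "rho \<beta> n i (rho \<beta> n j f) = rho \<beta> n j (rho \<beta> n i f)"
proof
  fix v :: "int \<Rightarrow> int"
  have "v \<circ> refl_gen i \<circ> refl_gen j = v \<circ> refl_gen j \<circ> refl_gen i"
    using refl_gen_commute[OF assms(1)] by (simp add: comp_assoc)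
  then show "rho \<beta> n i (rho \<beta> n j f) v = rho \<beta> n j (rho \<beta> n i f) v"
    using assms des_far[OF assms(1), of v]
    by (cases "v \<in> signed_perms n") (simp_all add: rho_def distrib_left ac_simps)
qed

lemma rho_braid3:
  assumes "1 \<le> i" "i + 1 < n"
  shows "rho \<beta> n i (rho \<beta> n (i + 1) (rho \<beta> n i f)) = rho \<beta> n (i + 1) (rho \<beta> n i (rho \<beta> n (i + 1) f))"
proof
  fix v :: "int \<Rightarrow> int"
  show "rho \<beta> n i (rho \<beta> n (i + 1) (rho \<beta> n i f)) v = rho \<beta> n (i + 1) (rho \<beta> n i (rho \<beta> n (i + 1) f)) v"
  proof (cases "v \<in> signed_perms n")
    case v: True
    have br: "v \<circ> refl_gen i \<circ> refl_gen (i + 1) \<circ> refl_gen i =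
        v \<circ> refl_gen (i + 1) \<circ> refl_gen i \<circ> refl_gen (i + 1)"
      using refl_gen_braid3[OF assms(1)] by (simp add: comp_assoc)
    have i: "i < n" "i + 1 < n"
      using assms by auto
    note d = des_braid3[OF assms(1), of v] des_comp_refl_gen[where n = n]
    have "des i v \<longleftrightarrow> v (int i) > v (int i + 1)" "des (i + 1) v \<longleftrightarrow> v (int i + 1) > v (int i + 2)"
      using assms(1) by (simp_all add: des_def ac_simps)
    \<comment> \<open>The six cases are the relative orders of v(i), v(i + 1), v(i + 2); each fixes
      all descents that occur.\<close>
    then consider "des i v" "des (i + 1) v" "v (int i) > v (int i + 2)"
      | "des i v" "\<not> des (i + 1) v" "v (int i) > v (int i + 2)"
      | "des i v" "\<not> des (i + 1) v" "\<not> v (int i) > v (int i + 2)"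
      | "\<not> des i v" "des (i + 1) v" "v (int i) > v (int i + 2)"
      | "\<not> des i v" "des (i + 1) v" "\<not> v (int i) > v (int i + 2)"
      | "\<not> des i v" "\<not> des (i + 1) v" "\<not> v (int i) > v (int i + 2)"
      by (simp only: not_less) linarith
    then show ?thesis
      by cases (simp only: rho_def comp_refl_gen_signed_perms[OF i(1)]
          comp_refl_gen_signed_perms[OF i(2)] v d br if_True if_False simp_thms comp_refl_gen_twice;
          simp add: algebra_simps)+
  qed (simp add: rho_def)
qed

lemma rho_braid4:
  assumes "1 < n"
  shows "rho \<beta> n 0 (rho \<beta> n 1 (rho \<beta> n 0 (rho \<beta> n 1 f))) =
    rho \<beta> n 1 (rho \<beta> n 0 (rho \<beta> n 1 (rho \<beta> n 0 f)))"
proof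
  fix v :: "int \<Rightarrow> int"
  show "rho \<beta> n 0 (rho \<beta> n 1 (rho \<beta> n 0 (rho \<beta> n 1 f))) v =
    rho \<beta> n 1 (rho \<beta> n 0 (rho \<beta> n 1 (rho \<beta> n 0 f))) v"
  proof (cases "v \<in> signed_perms n")
    case v: True
    have br: "v \<circ> refl_gen 0 \<circ> refl_gen 1 \<circ> refl_gen 0 \<circ> refl_gen 1 =
        v \<circ> refl_gen 1 \<circ> refl_gen 0 \<circ> refl_gen 1 \<circ> refl_gen 0"
      using refl_gen_braid4 by (simp add: comp_assoc)
    have i: "0 < n" "1 < n"
      using assms by auto
    note d = des_braid4[OF v] des_comp_refl_gen[where n = n]
    \<comment> \<open>Ties are excluded, and eight patterns remain, one for each element of the
      group of rank two.\<close>
    have "v 1 \<noteq> 0" "v 2 \<noteq> 0" "v 1 \<noteq> v 2" "v 1 + v 2 \<noteq> 0"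
      using signed_perms_eq_0[OF v] signed_perms_inj[OF v, of 1 2] signed_perms_inj[OF v, of 1 "-2"]
        signed_perms_minus[OF v, of 2] by (simp_all add: add_eq_0_iff2)
    then consider "des 0 v" "des 1 v" "v 2 < 0" "v 1 + v 2 < 0"
      | "des 0 v" "\<not> des 1 v" "v 2 < 0" "v 1 + v 2 < 0"
      | "des 0 v" "\<not> des 1 v" "\<not> v 2 < 0" "v 1 + v 2 < 0"
      | "des 0 v" "\<not> des 1 v" "\<not> v 2 < 0" "\<not> v 1 + v 2 < 0"
      | "\<not> des 0 v" "des 1 v" "v 2 < 0" "v 1 + v 2 < 0"
      | "\<not> des 0 v" "des 1 v" "v 2 < 0" "\<not> v 1 + v 2 < 0"
      | "\<not> des 0 v" "des 1 v" "\<not> v 2 < 0" "\<not> v 1 + v 2 < 0"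
      | "\<not> des 0 v" "\<not> des 1 v" "\<not> v 2 < 0" "\<not> v 1 + v 2 < 0"
      by (simp add: des_def not_less) linarith
    then show ?thesis
      by cases (simp only: rho_def comp_refl_gen_signed_perms[OF i(1)]
          comp_refl_gen_signed_perms[OF i(2)] v d br if_True if_False simp_thms comp_refl_gen_twice;
          simp add: algebra_simps)+
  qed (simp add: rho_def)
qed

text \<open>\<open>fold\<close> applies the letters from left to right, so the left factor of a
  product acts before the right one, as in multiplication on the right of the basis.\<close>

definition act ::
    "'a::comm_ring_1 \<Rightarrow> nat \<Rightarrow> (free_word \<Rightarrow>\<^sub>0 'a) \<Rightarrow> ((int \<Rightarrow> int) \<Rightarrow> 'a) \<Rightarrow> (int \<Rightarrow> int) \<Rightarrow> 'a" where
  "act \<beta> n p f v =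
     (\<Sum>w\<in>Poly_Mapping.keys p. Poly_Mapping.lookup p w * fold (rho \<beta> n) (letters w) f v)"

lemma letters_zero [simp]: "letters 0 = []"
  by (simp add: zero_free_word_def)

lemma fold_rho_add:
  "fold (rho \<beta> n) is (\<lambda>v. f v + g v) = (\<lambda>v. fold (rho \<beta> n) is f v + fold (rho \<beta> n) is g v)"
  by (induction "is" arbitrary: f g) (simp_all add: rho_add)

lemma fold_rho_scale:
  "fold (rho \<beta> n) is (\<lambda>v. c * f v) = (\<lambda>v. c * fold (rho \<beta> n) is f v)"
  by (induction "is" arbitrary: f) (simp_all add: rho_scale)

lemma act_superset:
  assumes "finite S" "Poly_Mapping.keys p \<subseteq> S"
  shows "act \<beta> n p f v = (\<Sum>w\<in>S. Poly_Mapping.lookup p w * fold (rho \<beta> n) (letters w) f v)"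
  unfolding act_def using assms
  by (intro sum.mono_neutral_left) (auto simp: in_keys_iff)

lemma act_zero [simp]: "act \<beta> n 0 f = (\<lambda>v. 0)"
  by (simp add: fun_eq_iff act_def)

lemma act_single: "act \<beta> n (Poly_Mapping.single w c) f = (\<lambda>v. c * fold (rho \<beta> n) (letters w) f v)"
  by (simp add: fun_eq_iff act_def)

lemma act_one [simp]: "act \<beta> n 1 f = f"
  using act_single[of \<beta> n 0 1 f] by simp

lemma act_mono: "act \<beta> n (fa_mono is) f = fold (rho \<beta> n) is f"
  by (simp add: fa_mono_def act_single)

lemma act_const: "act \<beta> n (fa_const c) f = (\<lambda>v. c * f v)"
  by (simp add: fa_const_def act_single zero_free_word_def)

lemma act_add: "act \<beta> n (p + q) f = (\<lambda>v. act \<beta> n p f v + act \<beta> n q f v)"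
proof
  fix v
  let ?S = "Poly_Mapping.keys p \<union> Poly_Mapping.keys q"
  have "act \<beta> n (p + q) f v =
      (\<Sum>w\<in>?S. Poly_Mapping.lookup (p + q) w * fold (rho \<beta> n) (letters w) f v)"
    by (rule act_superset) (simp_all add: Poly_Mapping.keys_add)
  also have "\<dots> = act \<beta> n p f v + act \<beta> n q f v"
    by (simp add: act_superset[of ?S] lookup_add distrib_right sum.distrib)
  finally show "act \<beta> n (p + q) f v = act \<beta> n p f v + act \<beta> n q f v" .
qed

lemma act_fun_add: "act \<beta> n p (\<lambda>v. f v + g v) = (\<lambda>v. act \<beta> n p f v + act \<beta> n p g v)"
  by (simp add: fun_eq_iff act_def fold_rho_add distrib_left sum.distrib)

lemma act_fun_scale: "act \<beta> n p (\<lambda>v. c * f v) = (\<lambda>v. c * act \<beta> n p f v)"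
  by (simp add: fun_eq_iff act_def fold_rho_scale sum_distrib_left mult.left_commute)

lemma act_fun_zero [simp]: "act \<beta> n p (\<lambda>v. 0) = (\<lambda>v. 0)"
  using act_fun_scale[of \<beta> n p 0] by simp

lemma act_uminus: "act \<beta> n (- p) f = (\<lambda>v. - act \<beta> n p f v)"
  using act_add[of \<beta> n "- p" p f] by (simp add: fun_eq_iff add_eq_0_iff2)

lemma act_diff: "act \<beta> n (p - q) f = (\<lambda>v. act \<beta> n p f v - act \<beta> n q f v)"
  using act_add[of \<beta> n p "- q" f] by (simp add: act_uminus)

lemma act_sum: "act \<beta> n (sum p A) f v = (\<Sum>x\<in>A. act \<beta> n (p x) f v)"
  by (induction A rule: infinite_finite_induct) (simp_all add: act_add)

lemma act_mult: "act \<beta> n (p * q) f = act \<beta> n q (act \<beta> n p f)"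
proof (induction p rule: poly_mapping_add_induct)
  case (single w c)
  show ?case
  proof (induction q rule: poly_mapping_add_induct)
    case (single w' c')
    then show ?case
      by (simp add: mult_single act_single plus_free_word_def fold_rho_scale ac_simps)
  qed (simp_all add: distrib_left act_add)
qed (simp_all add: distrib_right act_add act_fun_add)

lemma act_id_relations:
  assumes "p \<in> id_relations \<beta> n"
  shows "act \<beta> n p f = (\<lambda>v. 0)"
proof -
  have "rho \<beta> n j (rho \<beta> n i f) v - rho \<beta> n i (rho \<beta> n j f) v = 0" if "Suc (Suc i) \<le> j" "j < n" for i j v
    using rho_commute[of i j n \<beta> f] that by simp
  with assms show ?thesis
    by (auto simp: id_relations_def act_diff act_mono act_mult act_const rho_scale rho_quadratic
      rho_braid3[simplified] rho_braid4[simplified] split: if_splits)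
qed

text \<open>The elements that act as zero on every function form a two-sided ideal containing the
  relations. Quantifying over all functions is what gives closure under left multiplication.\<close>

lemma act_id_ideal:
  assumes "p \<in> id_ideal \<beta> n"
  shows "act \<beta> n p f = (\<lambda>v. 0)"
proof -
  define K where "K = {p \<in> carrier (free_alg n). \<forall>f. act \<beta> n p f = (\<lambda>v. 0)}"
  interpret R: ring "free_alg n" by (rule ring_free_alg)
  have inv: "\<ominus>\<^bsub>free_alg n\<^esub> x = - x" if "x \<in> carrier (free_alg n)" for x
    using that by (intro R.minus_equality) auto
  have "ideal K (free_alg n)"
  proof (rule idealI[OF ring_free_alg])
    show "subgroup K (add_monoid (free_alg n))"
      by (rule R.add.subgroupI)
        (auto simp: K_def act_add inv act_uminus simp flip: a_inv_def intro!: exI[of _ 0])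
  qed (auto simp: K_def act_mult)
  moreover have "id_relations \<beta> n \<subseteq> K"
    using id_relations_carrier act_id_relations by (auto simp: K_def)
  ultimately have "id_ideal \<beta> n \<subseteq> K"
    unfolding id_ideal_def by (rule R.genideal_minimal)
  then show ?thesis
    using assms by (auto simp: K_def)
qed

lemma id_class_eqD:
  assumes "id_class \<beta> n p = id_class \<beta> n q" "p \<in> carrier (free_alg n)" "q \<in> carrier (free_alg n)"
  shows "act \<beta> n p f = act \<beta> n q f"
  using act_id_ideal[of "p - q" \<beta> n f] assms by (simp add: id_class_eq_iff act_diff fun_eq_iff)

definition basis_fun :: "(int \<Rightarrow> int) \<Rightarrow> (int \<Rightarrow> int) \<Rightarrow> 'a::comm_ring_1" where
  "basis_fun w v = (if v = w then 1 else 0)"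

definition unit_fun :: "(int \<Rightarrow> int) \<Rightarrow> 'a::comm_ring_1" where
  "unit_fun = basis_fun id"

lemma rho_basis_fun_ascent:
  assumes "v \<in> signed_perms n" "i < n" "\<not> des i v"
  shows "rho \<beta> n i (basis_fun v) = basis_fun (v \<circ> refl_gen i)"
proof
  fix u
  have "u \<circ> refl_gen i = v \<longleftrightarrow> u = v \<circ> refl_gen i"
    by (metis comp_refl_gen_twice)
  moreover have "v \<circ> refl_gen i \<in> signed_perms n" "des i (v \<circ> refl_gen i)"
    using assms by (simp_all add: des_comp_refl_gen)
  ultimately show "rho \<beta> n i (basis_fun v) u = basis_fun (v \<circ> refl_gen i) u"
    using assms by (auto simp: rho_def basis_fun_def simp del: o_apply)
qed

text \<open>Along a reduced word every step is an ascent, where \<open>rho\<close> moves a single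
  indicator function. This separates the classes of different group elements.\<close>

lemma fold_rho_reduced:
  "is_reduced_word n v is \<Longrightarrow> fold (rho \<beta> n) is unit_fun = basis_fun v"
proof (induction "is" arbitrary: v rule: rev_induct)
  case Nil
  then show ?case
    by (auto simp: is_reduced_word_def unit_fun_def id_def)
next
  case (snoc i "is")
  then have r: "i < n" "v \<in> signed_perms n" "des i v" "is_reduced_word n (v \<circ> refl_gen i) is"
    by (simp_all add: reduced_word_snoc_iff)
  have "fold (rho \<beta> n) (is @ [i]) unit_fun = rho \<beta> n i (fold (rho \<beta> n) is unit_fun)"
    by simp
  also have "\<dots> = rho \<beta> n i (basis_fun (v \<circ> refl_gen i))"
    by (rule arg_cong[OF snoc.IH[OF r(4)]])
  also have "\<dots> = basis_fun v"
    using rho_basis_fun_ascent[of "v \<circ> refl_gen i" n i \<beta>] des_comp_refl_gen[of v n i] r by simp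
  finally show ?case .
qed

section \<open>Reduced words and the basis \<open>u\<^sub>w\<close>\<close>

text \<open>Both i and j are descents of v, so v is a product, with lengths adding, of some u and
  the longest element of the subgroup generated by s_i and s_j. A reduced word of u followed by
  either alternating word connects the two given words: each end is a shorter instance covered by
  \<open>IH\<close>, and the alternating words differ by a braid relation.\<close>

lemma matsumoto_step:
  assumes red: "is_reduced_word n v (is @ [i])" "is_reduced_word n v (js @ [j])" and "i < j"
    and IH: "\<And>u ks ls. length ks < length (is @ [i]) \<Longrightarrow> is_reduced_word n u ks \<Longrightarrow>
      is_reduced_word n u ls \<Longrightarrow> id_eq \<beta> n (fa_mono ks) (fa_mono ls)"
  shows "id_eq \<beta> n (fa_mono (is @ [i])) (fa_mono (js @ [j]))"
proof -
  from red have v: "v \<in> signed_perms n" and i: "i < n" "des i v" and j: "j < n" "des j v"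
    and ris: "is_reduced_word n (v \<circ> refl_gen i) is"
    and rjs: "is_reduced_word n (v \<circ> refl_gen j) js"
    by (simp_all add: reduced_word_snoc_iff)
  have len: "length js = length is"
    using red by (simp add: is_reduced_word_def)
  have sub: "set is \<subseteq> {..<n}" "set js \<subseteq> {..<n}"
    using ris rjs by (auto simp: is_reduced_word_def)
  \<comment> \<open>\<open>ks\<close> spells u, and \<open>ci\<close>, \<open>cj\<close> are the
    alternating words without their last letters i and j.\<close>
  have key: ?thesis
    if "is_reduced_word n (v \<circ> refl_gen i) (ks @ ci)" "is_reduced_word n (v \<circ> refl_gen j) (ks @ cj)"
      and braid: "id_eq \<beta> n (fa_mono (ci @ [i])) (fa_mono (cj @ [j]))" for ks ci cj
  proof -
    have ks: "set ks \<subseteq> {..<n}"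
      using that by (simp add: is_reduced_word_def)
    have "id_eq \<beta> n (fa_mono is * fa_mono [i]) (fa_mono (ks @ ci) * fa_mono [i])"
      using i by (intro id_eq_mult_right IH[OF _ ris that(1)]) auto
    also have "fa_mono (ks @ ci) * fa_mono [i] = fa_mono ks * fa_mono (ci @ [i])"
      by (simp add: fa_mono_append mult.assoc)
    also have "id_eq \<beta> n \<dots> (fa_mono ks * fa_mono (cj @ [j]))"
      using ks by (intro id_eq_mult_left braid) auto
    also have "fa_mono ks * fa_mono (cj @ [j]) = fa_mono (ks @ cj) * fa_mono [j]"
      by (simp add: fa_mono_append mult.assoc)
    also have "id_eq \<beta> n \<dots> (fa_mono js * fa_mono [j])"
      using j len by (intro id_eq_mult_right id_eq_sym[OF IH[OF _ rjs that(2)]]) auto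
    finally show ?thesis
      by (simp add: fa_mono_append)
  qed
  note red_simps = reduced_word_snoc_iff comp_refl_gen_twice
  note d = des_comp_refl_gen[where n = n]
  consider "i + 2 \<le> j" | "1 \<le> i" "j = i + 1" | "i = 0" "j = 1"
    using \<open>i < j\<close> by linarith
  then show ?thesis
  proof cases
    case 1
    have c: "v \<circ> refl_gen i \<circ> refl_gen j = v \<circ> refl_gen j \<circ> refl_gen i"
      using refl_gen_commute[OF 1] by (simp add: comp_assoc)
    obtain ks where ks: "is_reduced_word n (v \<circ> refl_gen i \<circ> refl_gen j) ks"
      using ex_reduced_word[of "v \<circ> refl_gen i \<circ> refl_gen j" n] v i j by auto
    show ?thesis
    proof (rule key[of ks "[j]" "[i]"])
      show "is_reduced_word n (v \<circ> refl_gen i) (ks @ [j])"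
        using ks v i j des_far[OF 1, of v] by (simp add: red_simps)
      show "is_reduced_word n (v \<circ> refl_gen j) (ks @ [i])"
        using ks v i j des_far[OF 1, of v] unfolding c by (simp add: red_simps)
      show "id_eq \<beta> n (fa_mono ([j] @ [i])) (fa_mono ([i] @ [j]))"
        using id_eq_sym[OF id_eq_commute[OF 1 j(1)]] by simp
    qed
  next
    case 2
    have n: "i + 1 < n"
      using 2 j by simp
    have c: "v \<circ> refl_gen i \<circ> refl_gen j \<circ> refl_gen i = v \<circ> refl_gen j \<circ> refl_gen i \<circ> refl_gen j"
      using refl_gen_braid3[OF 2(1)] 2(2) by (simp add: comp_assoc)
    \<comment> \<open>The two descents imply the third comparison, so every letter removed in turn
      is a descent.\<close>
    have lt: "v (int i) > v (int i + 2)"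
      using i(2) j(2) 2 by (simp add: des_def ac_simps)
    note d3 = des_braid3[OF 2(1), of v, folded 2(2)]
    obtain ks where ks: "is_reduced_word n (v \<circ> refl_gen i \<circ> refl_gen j \<circ> refl_gen i) ks"
      using ex_reduced_word[of "v \<circ> refl_gen i \<circ> refl_gen j \<circ> refl_gen i" n] v i j by auto
    have "is_reduced_word n (v \<circ> refl_gen i) ((ks @ [i]) @ [j])"
      unfolding reduced_word_snoc_iff using ks v i j lt by (simp add: d3)
    moreover have "is_reduced_word n (v \<circ> refl_gen j) ((ks @ [j]) @ [i])"
      unfolding reduced_word_snoc_iff using ks[unfolded c] v i j lt by (simp add: d3)
    moreover have "id_eq \<beta> n (fa_mono ([i, j] @ [i])) (fa_mono ([j, i] @ [j]))"
      using id_eq_braid3[OF 2(1) n] 2(2) by simp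
    ultimately show ?thesis
      using key[of ks "[i, j]" "[j, i]"] by simp
  next
    case 3
    have c: "v \<circ> refl_gen i \<circ> refl_gen j \<circ> refl_gen i \<circ> refl_gen j =
        v \<circ> refl_gen j \<circ> refl_gen i \<circ> refl_gen j \<circ> refl_gen i"
      using refl_gen_braid4 3 by (simp add: comp_assoc)
    \<comment> \<open>These imply v(2) < 0 and v(1) + v(2) < 0, so every letter removed in turn is a
      descent.\<close>
    have neg: "v 1 < 0" "v 2 < v 1"
      using i(2) j(2) 3 by (auto simp: des_def)
    note d4 = des_braid4[OF v, folded 3]
    obtain ks where ks: "is_reduced_word n (v \<circ> refl_gen i \<circ> refl_gen j \<circ> refl_gen i \<circ> refl_gen j) ks"
      using ex_reduced_word[of "v \<circ> refl_gen i \<circ> refl_gen j \<circ> refl_gen i \<circ> refl_gen j" n] v i j by auto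
    have "is_reduced_word n (v \<circ> refl_gen i) (((ks @ [j]) @ [i]) @ [j])"
      unfolding reduced_word_snoc_iff using ks v i j neg by (simp add: d4)
    moreover have "is_reduced_word n (v \<circ> refl_gen j) (((ks @ [i]) @ [j]) @ [i])"
      unfolding reduced_word_snoc_iff using ks[unfolded c] v i j neg by (simp add: d4)
    moreover have "id_eq \<beta> n (fa_mono ([j, i, j] @ [i])) (fa_mono ([i, j, i] @ [j]))"
      using id_eq_sym[OF id_eq_braid4] 3 j by simp
    ultimately show ?thesis
      using key[of ks "[j, i, j]" "[i, j, i]"] by simp
  qed
qed

theorem matsumoto:
  assumes "is_reduced_word n v is" "is_reduced_word n v js"
  shows "id_eq \<beta> n (fa_mono is) (fa_mono js)"
  using assms
proof (induction "length is" arbitrary: v "is" js rule: less_induct)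
  case less
  have len: "length js = length is"
    using less.prems by (simp add: is_reduced_word_def)
  show ?case
  proof (cases "is" rule: rev_cases)
    case Nil
    then show ?thesis
      using len by simp
  next
    case is': (snoc is' i)
    then obtain js' j where js': "js = js' @ [j]"
      using len by (cases js rule: rev_cases) auto
    have IH: "id_eq \<beta> n (fa_mono ks) (fa_mono ls)"
      if "length ks < length is" "is_reduced_word n u ks" "is_reduced_word n u ls" for u ks ls
      using less.hyps[OF that] .
    consider "i = j" | "i < j" | "j < i" by linarith
    then show ?thesis
    proof cases
      case 1
      have "id_eq \<beta> n (fa_mono is' * fa_mono [i]) (fa_mono js' * fa_mono [i])"
        using less.prems is' js' 1
        by (intro id_eq_mult_right IH[of _ "v \<circ> refl_gen i"]) (auto simp: reduced_word_snoc_iff)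
      then show ?thesis
        using is' js' 1 by (simp add: fa_mono_append)
    next
      case 2
      then show ?thesis
        using matsumoto_step[of n v is' i js' j \<beta>] less.prems IH is' js' by blast
    next
      case 3
      have "id_eq \<beta> n (fa_mono js) (fa_mono is)"
        using matsumoto_step[of n v js' j is' i \<beta>] less.prems IH is' js' 3 len by metis
      then show ?thesis
        by (rule id_eq_sym)
    qed
  qed
qed

section \<open>Coefficients in the standard basis\<close>

definition red_word :: "nat \<Rightarrow> (int \<Rightarrow> int) \<Rightarrow> nat list" where
  "red_word n v = (SOME is. is_reduced_word n v is)"

lemma red_word: "v \<in> signed_perms n \<Longrightarrow> is_reduced_word n v (red_word n v)"
  unfolding red_word_def using ex_reduced_word by (rule someI_ex)

lemma red_word_carrier [simp]: "v \<in> signed_perms n \<Longrightarrow> fa_mono (red_word n v) \<in> carrier (free_alg n)"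
  using red_word[of v n] by (intro fa_mono_carrier) (simp add: is_reduced_word_def)

lemma red_word_mult_ascent:
  assumes "v \<in> signed_perms n" "i < n" "\<not> des i v"
  shows "id_eq \<beta> n (fa_mono (red_word n v) * fa_mono [i]) (fa_mono (red_word n (v \<circ> refl_gen i)))"
proof -
  have "is_reduced_word n (v \<circ> refl_gen i) (red_word n v @ [i])"
    using assms by (simp add: reduced_word_snoc_iff des_comp_refl_gen red_word)
  then show ?thesis
    using matsumoto[of n _ "red_word n v @ [i]" "red_word n (v \<circ> refl_gen i)" \<beta>] red_word[of "v \<circ> refl_gen i" n]
      assms by (simp add: fa_mono_append)
qed

text \<open>Up to congruence the reduced word of v may be taken to end in i, and then the quadratic
  relation applies.\<close>

lemma red_word_mult_descent:
  assumes v: "v \<in> signed_perms n" and i: "i < n" and d: "des i v"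
  shows "id_eq \<beta> n (fa_mono (red_word n v) * fa_mono [i]) (fa_const \<beta> * fa_mono (red_word n v))"
proof -
  define u where "u = v \<circ> refl_gen i"
  have u: "u \<in> signed_perms n" "\<not> des i u" "u \<circ> refl_gen i = v"
    using assms by (simp_all add: u_def des_comp_refl_gen)
  note asc = red_word_mult_ascent[OF u(1) i u(2), of \<beta>, unfolded u(3)]
  have mi [simp]: "fa_mono [i] \<in> carrier (free_alg n)"
    using i by simp
  have "id_eq \<beta> n (fa_mono (red_word n v) * fa_mono [i])
      ((fa_mono (red_word n u) * fa_mono [i]) * fa_mono [i])"
    by (intro id_eq_mult_right id_eq_sym[OF asc] mi)
  also have "(fa_mono (red_word n u) * fa_mono [i]) * fa_mono [i] =
      fa_mono (red_word n u) * fa_mono [i, i]"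
    by (simp add: mult.assoc fa_mono_append[of "[i]" "[i]", simplified])
  also have "id_eq \<beta> n \<dots> (fa_mono (red_word n u) * (fa_const \<beta> * fa_mono [i]))"
    using u by (intro id_eq_mult_left id_eq_quadratic i) simp
  also have "fa_mono (red_word n u) * (fa_const \<beta> * fa_mono [i]) =
      fa_const \<beta> * (fa_mono (red_word n u) * fa_mono [i])"
    by (metis fa_const_commute mult.assoc)
  also have "id_eq \<beta> n \<dots> (fa_const \<beta> * fa_mono (red_word n v))"
    by (intro id_eq_mult_left asc) simp
  finally show ?thesis .
qed

text \<open>A representative in the free algebra of the sum of c(v) u_v. As \<open>red_word\<close>
  makes the same choice as \<open>u_elem\<close>, its class is the sum that occurs in
  \<open>u_coeff\<close>.\<close>

definition expansion :: "nat \<Rightarrow> ((int \<Rightarrow> int) \<Rightarrow> 'a) \<Rightarrow> free_word \<Rightarrow>\<^sub>0 'a::comm_ring_1" where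
  "expansion n c = (\<Sum>v\<in>signed_perms n. fa_const (c v) * fa_mono (red_word n v))"

lemma expansion_carrier [simp]: "expansion n c \<in> carrier (free_alg n)"
  unfolding expansion_def by (intro sum_carrier mult_carrier fa_const_carrier red_word_carrier)

text \<open>This is the linear independence of the u_v: the coefficients are recovered from the
  action.\<close>

lemma act_expansion:
  assumes "w \<in> signed_perms n"
  shows "act \<beta> n (expansion n c) unit_fun w = c w"
proof -
  have "act \<beta> n (expansion n c) unit_fun w = (\<Sum>v\<in>signed_perms n. c v * basis_fun v w)"
    unfolding expansion_def act_sum
    by (intro sum.cong refl)
      (simp add: act_mult act_const act_mono fold_rho_scale fold_rho_reduced[OF red_word])
  also have "\<dots> = (\<Sum>v\<in>signed_perms n. if w = v then c v else 0)"
    by (intro sum.cong refl) (simp add: basis_fun_def)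
  also have "\<dots> = c w"
    using assms by (simp add: finite_signed_perms)
  finally show ?thesis .
qed

lemma expansion_unit: "id_eq \<beta> n (expansion n unit_fun) (1 :: free_word \<Rightarrow>\<^sub>0 'a::comm_ring_1)"
proof -
  have "red_word n id = []"
    using red_word[of id n] by (simp add: is_reduced_word_def)
  then have "expansion n unit_fun = (\<Sum>v\<in>signed_perms n. if v = id then 1 else (0 :: free_word \<Rightarrow>\<^sub>0 'a))"
    unfolding expansion_def by (intro sum.cong refl) (simp add: unit_fun_def basis_fun_def)
  also have "\<dots> = 1"
    by (simp add: finite_signed_perms)
  finally show ?thesis
    by simp
qed

text \<open>The involution v to v s_i exchanges ascents and descents. Reindexing by it collects both
  contributions at the descents, where they add up to \<open>rho\<close>.\<close>

lemma expansion_mult: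
  assumes i: "i < n"
  shows "id_eq \<beta> n (expansion n c * fa_mono [i]) (expansion n (rho \<beta> n i c))"
proof -
  let ?D = "{v \<in> signed_perms n. des i v}" and ?N = "{v \<in> signed_perms n. \<not> des i v}"
  let ?m = "\<lambda>v. fa_mono (red_word n v) :: free_word \<Rightarrow>\<^sub>0 'a"
  let ?g = "\<lambda>v. if des i v then fa_const (\<beta> * c v) * ?m v else fa_const (c v) * ?m (v \<circ> refl_gen i)"
  have fin: "finite ?D" "finite ?N" "?D \<inter> ?N = {}" and un: "signed_perms n = ?D \<union> ?N"
    using finite_signed_perms[of n] by auto
  have "id_eq \<beta> n (expansion n c * fa_mono [i]) (\<Sum>v\<in>signed_perms n. ?g v)"
    unfolding expansion_def sum_distrib_right
  proof (rule id_eq_sum)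
    fix v assume v: "v \<in> signed_perms n"
    show "id_eq \<beta> n (fa_const (c v) * ?m v * fa_mono [i]) (?g v)"
    proof (cases "des i v")
      case True
      then show ?thesis
        using id_eq_mult_left[OF red_word_mult_descent[OF v i True], of "fa_const (c v)" \<beta>]
        by (simp add: fa_const_mult mult.assoc mult.commute[of \<beta>])
    next
      case False
      then show ?thesis
        using id_eq_mult_left[OF red_word_mult_ascent[OF v i False], of "fa_const (c v)" \<beta>]
        by (simp add: mult.assoc)
    qed
  qed
  also have "(\<Sum>v\<in>signed_perms n. ?g v) = sum ?g (?D \<union> ?N)"
    by (rule arg_cong[OF un])
  also have "\<dots> = (\<Sum>v\<in>?D. fa_const (\<beta> * c v) * ?m v) + (\<Sum>v\<in>?N. fa_const (c v) * ?m (v \<circ> refl_gen i))"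
    unfolding sum.union_disjoint[OF fin] by (intro arg_cong2[where f = "(+)"] sum.cong) auto
  also have "(\<Sum>v\<in>?N. fa_const (c v) * ?m (v \<circ> refl_gen i)) =
      (\<Sum>v\<in>?D. fa_const (c (v \<circ> refl_gen i)) * ?m v)"
    by (rule sum.reindex_bij_witness[of _ "\<lambda>v. v \<circ> refl_gen i" "\<lambda>v. v \<circ> refl_gen i"])
      (use i in \<open>auto simp: des_comp_refl_gen simp del: o_apply\<close>)
  also have "(\<Sum>v\<in>?D. fa_const (\<beta> * c v) * ?m v) + (\<Sum>v\<in>?D. fa_const (c (v \<circ> refl_gen i)) * ?m v) =
      (\<Sum>v\<in>?D. fa_const (rho \<beta> n i c v) * ?m v)"
    by (simp add: rho_def fa_const_add distrib_right sum.distrib)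
  also have "\<dots> = expansion n (rho \<beta> n i c)"
    unfolding expansion_def
    by (rule sum.mono_neutral_left) (auto simp: finite_signed_perms rho_def)
  finally show ?thesis .
qed

lemma expansion_word:
  "set is \<subseteq> {..<n} \<Longrightarrow> id_eq \<beta> n (fa_mono is) (expansion n (fold (rho \<beta> n) is unit_fun))"
proof (induction "is" rule: rev_induct)
  case Nil
  show ?case
    using id_eq_sym[OF expansion_unit] by simp
next
  case (snoc i "is")
  then have i: "i < n" by simp
  have "id_eq \<beta> n (fa_mono is * fa_mono [i])
      (expansion n (fold (rho \<beta> n) is unit_fun) * fa_mono [i])"
    using snoc by (intro id_eq_mult_right) auto
  also have "id_eq \<beta> n \<dots> (expansion n (rho \<beta> n i (fold (rho \<beta> n) is unit_fun)))"
    by (rule expansion_mult[OF i])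
  finally show ?case
    by (simp add: fa_mono_append)
qed

lemma expansion_add: "expansion n (\<lambda>v. c v + d v) = expansion n c + expansion n d"
  by (simp add: expansion_def fa_const_add distrib_right sum.distrib)

lemma expansion_scale: "expansion n (\<lambda>v. k * c v) = fa_const k * expansion n c"
  by (simp add: expansion_def fa_const_mult sum_distrib_left mult.assoc)

text \<open>The spanning half, with the coefficients named: an element is determined by its action
  on \<open>unit_fun\<close>.\<close>

lemma id_eq_expansion:
  assumes "p \<in> carrier (free_alg n)"
  shows "id_eq \<beta> n p (expansion n (act \<beta> n p unit_fun))"
proof -
  let ?t = "\<lambda>w. Poly_Mapping.single w (Poly_Mapping.lookup p w)"
  \<comment> \<open>Running over subsets of the support keeps the letters of all words below
    \<open>n\<close>.\<close>
  have "id_eq \<beta> n (\<Sum>w\<in>A. ?t w) (expansion n (act \<beta> n (\<Sum>w\<in>A. ?t w) unit_fun))"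
    if "A \<subseteq> Poly_Mapping.keys p" for A
    using that
  proof (induction A rule: infinite_finite_induct)
    case (infinite A)
    then show ?case
      using finite_subset by fastforce
  next
    case empty
    show ?case
      by (simp add: expansion_def)
  next
    case (insert w A)
    then have "set (letters w) \<subseteq> {..<n}"
      using assms by (auto simp: carrier_free_alg)
    then have "id_eq \<beta> n (?t w) (expansion n (act \<beta> n (?t w) unit_fun))"
      unfolding single_eq_const_mono act_mult act_const act_mono fold_rho_scale expansion_scale
      by (intro id_eq_mult_left expansion_word) auto
    then show ?case
      using insert by (simp add: act_add expansion_add id_eq_add)
  qed
  from this[OF subset_refl] show ?thesis
    by (simp flip: poly_mapping_eq_sum_single)
qed

lemma id_class_expansion:
  fixes c :: "(int \<Rightarrow> int) \<Rightarrow> 'a::comm_ring_1"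
  shows "finsum (id_alg \<beta> n)
      (\<lambda>v. id_class \<beta> n (fa_const (c v)) \<otimes>\<^bsub>id_alg \<beta> n\<^esub> u_elem \<beta> n v) (signed_perms n) =
    id_class \<beta> n (expansion n c)"
proof -
  interpret Q: ring "id_alg \<beta> n" by (rule ring_id_alg)
  have "id_class \<beta> n (expansion n c) =
      finsum (id_alg \<beta> n) (\<lambda>v. id_class \<beta> n (fa_const (c v) * fa_mono (red_word n v))) (signed_perms n)"
    unfolding expansion_def by (rule id_class_sum) (auto simp: finite_signed_perms)
  also have "\<dots> = finsum (id_alg \<beta> n)
      (\<lambda>v. id_class \<beta> n (fa_const (c v)) \<otimes>\<^bsub>id_alg \<beta> n\<^esub> u_elem \<beta> n v) (signed_perms n)"
    by (intro Q.finsum_cong') (auto simp: id_class_mult u_elem_def red_word_def[symmetric])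
  finally show ?thesis ..
qed

text \<open>Spanning supplies a coefficient function for the description, and independence makes its
  value at \<open>w\<close> unique.\<close>

theorem u_coeff_id_class:
  assumes p: "p \<in> carrier (free_alg n)" and w: "w \<in> signed_perms n"
  shows "u_coeff \<beta> n (id_class \<beta> n p) w = act \<beta> n p unit_fun w"
  unfolding u_coeff_def id_class_expansion
proof (rule the_equality)
  show "\<exists>c. c w = act \<beta> n p unit_fun w \<and> id_class \<beta> n p = id_class \<beta> n (expansion n c)"
    using id_eq_expansion[OF p, of \<beta>] p
    by (intro exI[of _ "act \<beta> n p unit_fun"]) (simp add: id_class_eq_iff id_eq_def)
next
  fix k assume "\<exists>c. c w = k \<and> id_class \<beta> n p = id_class \<beta> n (expansion n c)"
  then obtain c where "c w = k" "id_class \<beta> n p = id_class \<beta> n (expansion n c)"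
    by blast
  then show "k = act \<beta> n p unit_fun w"
    using id_class_eqD[of \<beta> n p "expansion n c" unit_fun] p act_expansion[OF w, of \<beta> c] by simp
qed

text \<open>Faithfulness, tested on \<open>unit_fun\<close> alone; it carries identities between
  operators back to the algebra.\<close>

lemma id_class_eqI:
  assumes "p \<in> carrier (free_alg n)" "q \<in> carrier (free_alg n)"
    and "act \<beta> n p unit_fun = act \<beta> n q unit_fun"
  shows "id_class \<beta> n p = id_class \<beta> n q"
  using id_eq_expansion[OF assms(1), of \<beta>] id_eq_sym[OF id_eq_expansion[OF assms(2), of \<beta>]] assms
  by (metis id_class_eq_iff id_eq_def id_eq_trans)

section \<open>Products over the boxes\<close>

lemma fplus_commute: "fplus \<beta> x y = fplus \<beta> y x"
  by (simp add: fplus_def ac_simps)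

text \<open>Reading the board meets the F(x_i) in decreasing order of i, whereas
  \<open>F_prod\<close> multiplies them in increasing order.\<close>

lemma prod_list_rev_commute:
  fixes xs :: "'m::monoid_mult list"
  assumes "\<And>x y. x \<in> set xs \<Longrightarrow> y \<in> set xs \<Longrightarrow> x * y = y * x"
  shows "prod_list (rev xs) = prod_list xs"
  using assms
proof (induction xs)
  case (Cons z xs)
  have "prod_list ys * z = z * prod_list ys" if "set ys \<subseteq> set xs" for ys
    using that Cons.prems by (induction ys) (auto simp: mult.assoc, metis mult.assoc)
  then show ?case
    using Cons by simp
qed simp

text \<open>The multiplicative form of the relations: the quadratic one becomes
  \<open>h_fplus\<close>, the braid relation of length three the Yang--Baxter equation. For factors
  1 + x u_i the side condition of \<open>h_braid4\<close> says that the two sides have the same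
  coefficient of u_0 u_1, or equivalently of u_1 u_0. The other coefficients agree because the sides
  are mirror images and by the braid relation of length four.\<close>

locale yang_baxter =
  fixes \<beta> :: "'a::field" and n :: nat and h :: "nat \<Rightarrow> 'a \<Rightarrow> 'm::monoid_mult"
  assumes h_zero: "h i 0 = 1"
    and h_fplus: "i < n \<Longrightarrow> h i x * h i y = h i (fplus \<beta> x y)"
    and h_commute: "i + 2 \<le> j \<Longrightarrow> j < n \<Longrightarrow> h i x * h j y = h j y * h i x"
    and h_braid3: "1 \<le> i \<Longrightarrow> i + 1 < n \<Longrightarrow>
      h i y * h (i + 1) (fplus \<beta> x y) * h i x = h (i + 1) x * h i (fplus \<beta> x y) * h (i + 1) y"
    and h_braid4: "1 < n \<Longrightarrow> X * s = Y * fplus \<beta> s d + X * d * (1 + \<beta> * Y) \<Longrightarrow>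
      h 1 d * h 0 X * h 1 s * h 0 Y = h 0 Y * h 1 s * h 0 X * h 1 d"
begin

definition up :: "nat \<Rightarrow> 'a \<Rightarrow> 'm" where
  "up m x = prod_list (map (\<lambda>k. h k x) [m..<n])"

definition down :: "nat \<Rightarrow> 'a \<Rightarrow> 'm" where
  "down m x = prod_list (map (\<lambda>k. h k x) (rev [m..<n]))"

lemma up_ge [simp]: "n \<le> m \<Longrightarrow> up m x = 1"
  by (simp add: up_def)

lemma down_ge [simp]: "n \<le> m \<Longrightarrow> down m x = 1"
  by (simp add: down_def)

lemma up_rec: "m < n \<Longrightarrow> up m x = h m x * up (Suc m) x"
  by (simp add: up_def upt_conv_Cons)

lemma down_rec: "m < n \<Longrightarrow> down m x = down (Suc m) x * h m x"
  by (simp add: down_def upt_conv_Cons)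

lemma up_down_inverse:
  assumes "fplus \<beta> x y = 0"
  shows "up m x * down m y = 1" "down m y * up m x = 1"
proof -
  have h: "h m x * h m y = 1" "h m y * h m x = 1" if "m < n" for m
    using that assms by (simp_all add: h_fplus h_zero fplus_commute)
  have "up m x * down m y = 1 \<and> down m y * up m x = 1" if "m \<le> n"
    using that
  proof (induction m rule: inc_induct)
    case (step m)
    then have m: "m < n" and IH: "up (Suc m) x * down (Suc m) y = 1" "down (Suc m) y * up (Suc m) x = 1"
      by auto
    have "up m x * down m y = h m x * (up (Suc m) x * down (Suc m) y) * h m y"
      using m by (simp add: up_rec down_rec mult.assoc)
    moreover have "down m y * up m x = down (Suc m) y * (h m y * h m x) * up (Suc m) x"
      using m by (simp add: up_rec down_rec mult.assoc)
    ultimately show ?case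
      by (simp only: IH h[OF m] mult_1_right)
  qed simp
  then show "up m x * down m y = 1" "down m y * up m x = 1"
    by (cases "m \<le> n"; simp)+
qed

lemma h_down_commute:
  assumes "i + 2 \<le> m"
  shows "h i x * down m y = down m y * h i x"
proof (cases "m \<le> n")
  case True
  then show ?thesis
    using assms
  proof (induction m rule: inc_induct)
    case (step m)
    then have m: "m < n" "i + 2 \<le> m"
      and IH: "h i x * down (Suc m) y = down (Suc m) y * h i x" by auto
    have "h i x * down m y = (h i x * down (Suc m) y) * h m y"
      using m by (simp add: down_rec mult.assoc)
    also have "\<dots> = down (Suc m) y * (h i x * h m y)"
      by (simp only: IH mult.assoc)
    also have "h i x * h m y = h m y * h i x"
      using m by (intro h_commute)
    also have "down (Suc m) y * (h m y * h i x) = down m y * h i x"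
      using m by (simp add: down_rec mult.assoc)
    finally show ?case .
  qed simp
qed simp

lemma h_up_commute:
  assumes "i + 2 \<le> m"
  shows "h i x * up m y = up m y * h i x"
proof (cases "m \<le> n")
  case True
  then show ?thesis
    using assms
  proof (induction m rule: inc_induct)
    case (step m)
    then have m: "m < n" "i + 2 \<le> m"
      and IH: "h i x * up (Suc m) y = up (Suc m) y * h i x" by auto
    have "h i x * up m y = (h i x * h m y) * up (Suc m) y"
      using m by (simp add: up_rec mult.assoc)
    also have "h i x * h m y = h m y * h i x"
      using m by (intro h_commute)
    also have "h m y * h i x * up (Suc m) y = h m y * (up (Suc m) y * h i x)"
      by (simp only: IH mult.assoc)
    also have "\<dots> = up m y * h i x"
      using m by (simp add: up_rec mult.assoc)
    finally show ?case .
  qed simp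
qed simp

text \<open>The basic crossing, which leaves one factor behind, the future box. In the induction
  downwards from n - 1 the two outer factors h_m commute past all indices from m + 2 on, and the
  Yang--Baxter equation brings the middle factor from index m + 1 to m.\<close>

lemma up_down:
  assumes "1 \<le> m" "m < n"
  shows "up m y * down m x = down (Suc m) x * h m (fplus \<beta> x y) * up (Suc m) y"
proof -
  have "m \<le> n - 1"
    using assms by simp
  then show ?thesis
    using assms(1)
  proof (induction m rule: inc_induct)
    case base
    then show ?case
      using assms by (simp add: up_rec down_rec h_fplus fplus_commute)
  next
    case (step m)
    then have m: "m < n" "Suc m < n" by auto
    have "up m y * down m x = h m y * (up (Suc m) y * down (Suc m) x) * h m x"
      using m by (simp add: up_rec[of m] down_rec[of m] mult.assoc)
    also have "\<dots> = (h m y * down (m + 2) x) * h (Suc m) (fplus \<beta> x y) * (up (m + 2) y * h m x)"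
      using step by (simp add: mult.assoc)
    also have "\<dots> = down (m + 2) x * (h m y * h (m + 1) (fplus \<beta> x y) * h m x) * up (m + 2) y"
      using h_down_commute[of m "m + 2"] h_up_commute[of m "m + 2"] by (simp add: mult.assoc)
    also have "\<dots> = down (Suc m) x * h m (fplus \<beta> x y) * up (Suc m) y"
      using h_braid3[of m y x] step.prems m
      by (simp add: down_rec[of "Suc m"] up_rec[of "Suc m"] mult.assoc)
    finally show ?case .
  qed
qed

text \<open>Two consecutive decreasing products trade arguments at the price of a correction h_m(d),
  where d is the formal difference of x and y. The Yang--Baxter equation moves the correction from
  index m + 1 to m.\<close>

lemma down_exchange:
  assumes "fplus \<beta> y d = x" "1 \<le> m" "m < n"
  shows "down m x * down (Suc m) y = down m y * down (Suc m) x * h m d"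
proof -
  have "m \<le> n - 1"
    using assms by simp
  then show ?thesis
    using assms(2)
  proof (induction m rule: inc_induct)
    case base
    then show ?case
      using assms by (simp add: down_rec h_fplus)
  next
    case (step m)
    then have m: "m < n" "Suc m < n" by auto
    have "down m x * down (Suc m) y = down (Suc m) x * (h m x * down (m + 2) y) * h (Suc m) y"
      using m by (simp add: down_rec[of m] down_rec[of "Suc m" y] mult.assoc)
    also have "\<dots> = (down (Suc m) x * down (Suc (Suc m)) y) * h m x * h (Suc m) y"
      using h_down_commute[of m "m + 2"] by (simp add: mult.assoc)
    also have "\<dots> = down (Suc m) y * down (m + 2) x * (h (m + 1) d * h m x * h (m + 1) y)"
      using step by (simp add: mult.assoc)
    also have "h (m + 1) d * h m x * h (m + 1) y = h m y * h (m + 1) x * h m d"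
      using h_braid3[of m y d] step.prems m assms(1) by (simp add: fplus_commute)
    also have "down (Suc m) y * down (m + 2) x * (h m y * h (m + 1) x * h m d) =
        down (Suc m) y * (down (m + 2) x * h m y) * h (m + 1) x * h m d"
      by (simp add: mult.assoc)
    also have "down (m + 2) x * h m y = h m y * down (m + 2) x"
      using h_down_commute[of m "m + 2"] by simp
    also have "down (Suc m) y * (h m y * down (m + 2) x) * h (m + 1) x * h m d =
        down m y * down (Suc m) x * h m d"
      using m by (simp add: down_rec[of m y] down_rec[of "Suc m" x] mult.assoc)
    finally show ?case .
  qed
qed

text \<open>The mirror image: the correction stands on the left, so the one left over by
  \<open>down_exchange\<close> can be consumed here.\<close>

lemma up_exchange:
  assumes "fplus \<beta> y d = x" "1 \<le> m" "m < n"
  shows "up (Suc m) y * up m x = h m d * up (Suc m) x * up m y"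
proof -
  have "m \<le> n - 1"
    using assms by simp
  then show ?thesis
    using assms(2)
  proof (induction m rule: inc_induct)
    case base
    then show ?case
      using assms by (simp add: up_rec h_fplus fplus_commute)
  next
    case (step m)
    then have m: "m < n" "Suc m < n" by auto
    have "up (Suc m) y * up m x = h (Suc m) y * (up (m + 2) y * h m x) * up (Suc m) x"
      using m by (simp add: up_rec[of m] up_rec[of "Suc m" y] mult.assoc)
    also have "up (m + 2) y * h m x = h m x * up (m + 2) y"
      by (simp add: h_up_commute)
    also have "h (Suc m) y * (h m x * up (m + 2) y) * up (Suc m) x =
        h (Suc m) y * h m x * (up (Suc (Suc m)) y * up (Suc m) x)"
      by (simp add: mult.assoc)
    also have "\<dots> = (h (m + 1) y * h m x * h (m + 1) d) * up (m + 2) x * up (Suc m) y"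
      using step by (simp add: mult.assoc)
    also have "h (m + 1) y * h m x * h (m + 1) d = h m d * h (m + 1) x * h m y"
      using h_braid3[of m d y] step.prems m assms(1) by simp
    also have "(h m d * h (m + 1) x * h m y) * up (m + 2) x * up (Suc m) y =
        h m d * h (m + 1) x * (h m y * up (m + 2) x) * up (Suc m) y"
      by (simp add: mult.assoc)
    also have "h m y * up (m + 2) x = up (m + 2) x * h m y"
      using h_up_commute[of m "m + 2"] by simp
    also have "h m d * h (m + 1) x * (up (m + 2) x * h m y) * up (Suc m) y =
        h m d * up (Suc m) x * up m y"
      using m by (simp add: up_rec[of m y] up_rec[of "Suc m" x] mult.assoc)
    finally show ?case .
  qed
qed

end

section \<open>Commutation of the factors F of types B and C\<close>

locale bc_yang_baxter = yang_baxter \<beta> n h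
  for \<beta> :: "'a::field" and n :: nat and h :: "nat \<Rightarrow> 'a \<Rightarrow> 'm::monoid_mult" +
  fixes X :: bc_type
begin

text \<open>The square of \<open>h 0 x\<close> is \<open>h 0 (fplus \<beta> x x)\<close>, so F has a
  single factor with index 0 in both types.\<close>

definition diag :: "'a \<Rightarrow> 'a" where
  "diag x = (case X of TypeB \<Rightarrow> x | TypeC \<Rightarrow> fplus \<beta> x x)"

definition F :: "'a \<Rightarrow> 'm" where
  "F x = down 1 x * h 0 (diag x) * up 1 x"

lemma h_braid4_diag:
  assumes "1 < n" "fplus \<beta> y d = x"
  shows "h 1 d * h 0 (diag x) * h 1 (fplus \<beta> x y) * h 0 (diag y) =
    h 0 (diag y) * h 1 (fplus \<beta> x y) * h 0 (diag x) * h 1 d"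
proof (rule h_braid4[OF assms(1)])
  show "diag x * fplus \<beta> x y = diag y * fplus \<beta> (fplus \<beta> x y) d + diag x * d * (1 + \<beta> * diag y)"
    unfolding diag_def by (cases X) (simp_all add: fplus_def assms(2)[symmetric] algebra_simps)
qed

text \<open>Once the inner products have crossed, F(x) F(y) consists of two decreasing products,
  three middle factors and two increasing products. The correction h_1(d) from exchanging the
  decreasing ones passes through the middle by the relation of length four, which reverses the
  middle factors, and is consumed by the increasing ones.\<close>

lemma F_commute:
  assumes "1 \<le> n" "1 + \<beta> * y \<noteq> 0"
  shows "F x * F y = F y * F x"
proof (cases "n = 1")
  \<comment> \<open>Only the factors with index 0 are left.\<close>
  case True
  then have "n \<le> 1" "0 < n"
    by simp_all
  then show ?thesis
    unfolding F_def down_ge[OF \<open>n \<le> 1\<close>] up_ge[OF \<open>n \<le> 1\<close>] by (simp add: h_fplus fplus_commute)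
next
  case False
  then have n: "1 < n" using assms by simp
  \<comment> \<open>The formal difference of x and y, which is where 1 + \<beta> y has to be
    invertible.\<close>
  define d where "d = (x - y) / (1 + \<beta> * y)"
  have d: "fplus \<beta> y d = x"
    using assms(2) by (simp add: fplus_def d_def) (simp add: divide_simps, simp add: algebra_simps)
  have F: "F x * F y = (down 1 x * down 2 y) * h 0 (diag x) * h 1 (fplus \<beta> x y) * h 0 (diag y) * (up 2 x * up 1 y)"
    for x y
  proof -
    have "F x * F y = down 1 x * h 0 (diag x) * (up 1 x * down 1 y) * h 0 (diag y) * up 1 y"
      by (simp add: F_def mult.assoc)
    also have "\<dots> = down 1 x * (h 0 (diag x) * down 2 y) * h 1 (fplus \<beta> x y) * (up 2 x * h 0 (diag y)) * up 1 y"
      using up_down[of 1 x y] n by (simp add: mult.assoc fplus_commute[of \<beta> y x] numeral_2_eq_2)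
    also have "h 0 (diag x) * down 2 y = down 2 y * h 0 (diag x)"
      by (rule h_down_commute) simp
    also have "up 2 x * h 0 (diag y) = h 0 (diag y) * up 2 x"
      by (rule h_up_commute[symmetric]) simp
    finally show ?thesis
      by (simp add: mult.assoc)
  qed
  have "F x * F y = down 1 y * down 2 x *
      (h 1 d * h 0 (diag x) * h 1 (fplus \<beta> x y) * h 0 (diag y)) * (up 2 x * up 1 y)"
    using down_exchange[OF d, of 1] n by (simp add: F mult.assoc numeral_2_eq_2)
  also have "\<dots> = down 1 y * down 2 x *
      (h 0 (diag y) * h 1 (fplus \<beta> x y) * h 0 (diag x)) * (h 1 d * up 2 x * up 1 y)"
    unfolding h_braid4_diag[OF n d] by (simp add: mult.assoc)
  also have "h 1 d * up 2 x * up 1 y = up 2 y * up 1 x"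
    using up_exchange[OF d, of 1] n by (simp add: numeral_2_eq_2)
  also have "down 1 y * down 2 x * (h 0 (diag y) * h 1 (fplus \<beta> x y) * h 0 (diag x)) * (up 2 y * up 1 x) = F y * F x"
    by (simp add: F[of y x] mult.assoc fplus_commute[of \<beta> y x])
  finally show ?thesis .
qed

end

text \<open>
  Reading the weights \<open>p\<^sub>1, p\<^sub>2, \<dots>\<close> from left to right, each new factor \<open>down m p\<^sub>t\<close> is pushed
  through the columns of the board. Each column absorbs one box and passes on \<open>down (m + 1) p\<^sub>t\<close>.
\<close>

locale board = bc_yang_baxter \<beta> n h X
  for \<beta> :: "'a::field" and n :: nat and h :: "nat \<Rightarrow> 'a \<Rightarrow> 'm::monoid_mult" and X :: bc_type +
  fixes a b x :: "nat \<Rightarrow> 'a"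
  assumes n: "1 \<le> n" and nonzero: "\<And>i. 1 + \<beta> * x i \<noteq> 0"
begin

section \<open>Filling the board column by column\<close>

definition p :: "nat \<Rightarrow> 'a" where
  "p i = (if i \<le> n then x (n + 1 - i) else a (i - n))"

definition q :: "nat \<Rightarrow> 'a" where
  "q j = (if j \<le> n then x j else b (j - n))"

definition box :: "nat \<Rightarrow> nat \<Rightarrow> 'm" where
  "box i j = h (box_refl n (i, j)) (box_wt X \<beta> n a b x (i, j))"

lemma box_eq: "i + j > n + 1 \<Longrightarrow> box i j = h (i + j - n - 1) (fplus \<beta> (p i) (q j))"
  by (simp add: box_def box_refl_def box_wt_def p_def q_def)

lemma box_diag: "1 \<le> j \<Longrightarrow> j \<le> n \<Longrightarrow> box (n + 1 - j) j = h 0 (diag (x j))"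
  unfolding box_def diag_def by (cases X) (auto simp: box_refl_def box_wt_def)

text \<open>The first row of column j: the diagonal row for j \<le> n, and row 1 beyond.\<close>

definition lo :: "nat \<Rightarrow> nat" where
  "lo j = max 1 (n + 1 - j)"

text \<open>Column j once p_1, ..., p_t have been read: its boxes so far, then the part of the
  increasing product not yet crossed. That part starts at t + j - n, the index of the next box (t +
  1, j).\<close>

definition col :: "nat \<Rightarrow> nat \<Rightarrow> 'm" where
  "col j t = prod_list (map (\<lambda>i. box i j) [lo j..<Suc (min t (2 * n - j))]) * up (t + j - n) (q j)"

lemma prod_boxes_down_commute:
  assumes "\<And>i. i \<in> set is \<Longrightarrow> n + 1 \<le> i + j \<and> i + j - n - 1 + 2 \<le> m"
  shows "prod_list (map (\<lambda>i. box i j) is) * down m y = down m y * prod_list (map (\<lambda>i. box i j) is)"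
  using assms
proof (induction "is")
  case (Cons i "is")
  let ?P = "prod_list (map (\<lambda>i. box i j) is)"
  have b: "box i j * down m y = down m y * box i j"
    using Cons.prems by (simp add: box_def box_refl_def h_down_commute)
  have IH: "?P * down m y = down m y * ?P"
    using Cons by simp
  have "(box i j * ?P) * down m y = (box i j * down m y) * ?P"
    by (simp only: mult.assoc IH)
  then show ?case
    by (simp add: b mult.assoc)
qed simp

text \<open>While the column is incomplete the crossing is \<open>up_down\<close>. The earlier boxes
  have index at most t + j - n - 1, two below the start of the shortened decreasing product, and
  commute with it. Once the column is complete, the increasing and decreasing products start at n or
  later and are empty.\<close>

lemma col_absorb:
  assumes "n + 1 \<le> t + j" "1 \<le> j" "j < 2 * n"
  shows "col j t * down (t + j - n) (p (Suc t)) = down (Suc t + j - n) (p (Suc t)) * col j (Suc t)"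
proof (cases "t + j < 2 * n")
  case True
  define m where "m = t + j - n"
  define P where "P = prod_list (map (\<lambda>i. box i j) [lo j..<Suc t])"
  have m: "1 \<le> m" "m < n" "Suc t + j - n = Suc m"
    using True assms by (auto simp: m_def)
  have le: "lo j \<le> Suc t"
    using assms by (simp add: lo_def)
  have min: "min t (2 * n - j) = t" "min (Suc t) (2 * n - j) = Suc t"
    using True by auto
  have b: "box (Suc t) j = h m (fplus \<beta> (p (Suc t)) (q j))"
    using assms by (simp add: box_eq m_def)
  have c: "col j t = P * up m (q j)" "col j (Suc t) = P * box (Suc t) j * up (Suc m) (q j)"
    using le m(3) min unfolding col_def P_def m_def by (simp_all add: min)
  have P: "P * down (Suc m) (p (Suc t)) = down (Suc m) (p (Suc t)) * P"
    unfolding P_def by (rule prod_boxes_down_commute) (use assms in \<open>auto simp: m_def lo_def\<close>)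
  have "col j t * down m (p (Suc t)) = P * (up m (q j) * down m (p (Suc t)))"
    by (simp add: c mult.assoc)
  also have "\<dots> = (P * down (Suc m) (p (Suc t))) * box (Suc t) j * up (Suc m) (q j)"
    by (simp add: up_down[OF m(1,2)] b mult.assoc)
  also have "\<dots> = down (Suc m) (p (Suc t)) * col j (Suc t)"
    unfolding P by (simp add: c mult.assoc)
  finally show ?thesis
    by (simp only: m(3) flip: m_def)
next
  case False
  then have m: "min (Suc t) (2 * n - j) = min t (2 * n - j)" and "n \<le> t + j - n" "n \<le> Suc t + j - n"
    by auto
  then have one: "up (t + j - n) z = 1" "up (Suc t + j - n) z = 1"
      "down (t + j - n) z = 1" "down (Suc t + j - n) z = 1" for z
    by (auto intro: up_ge down_ge)
  show ?thesis
    unfolding col_def m one by (simp only: mult_1_left mult_1_right)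
qed

text \<open>The decreasing product enters at the rightmost column, starts one index higher after
  each column, and is empty when it leaves on the left.\<close>

lemma cols_absorb:
  assumes "n + 1 \<le> t + j" "1 \<le> j" "j \<le> 2 * n"
  shows "prod_list (map (\<lambda>j. col j t) (rev [j..<2 * n])) * down (t + j - n) (p (Suc t)) =
    prod_list (map (\<lambda>j. col j (Suc t)) (rev [j..<2 * n]))"
  using assms(3,1,2)
proof (induction j rule: inc_induct)
  case base
  have "down (t + 2 * n - n) (p (Suc t)) = 1"
    by (rule down_ge) simp
  then show ?case
    by (simp only: upt_conv_Nil[OF order_refl] rev.simps list.map prod_list.Nil mult_1_left)
next
  case (step j)
  let ?P = "\<lambda>t. prod_list (map (\<lambda>j. col j t) (rev [Suc j..<2 * n]))"
  have j: "[j..<2 * n] = j # [Suc j..<2 * n]"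
    using step.hyps by (intro upt_conv_Cons)
  have IH: "?P t * down (Suc t + j - n) (p (Suc t)) = ?P (Suc t)"
    using step by simp
  have "prod_list (map (\<lambda>j. col j t) (rev [j..<2 * n])) * down (t + j - n) (p (Suc t)) =
      ?P t * (col j t * down (t + j - n) (p (Suc t)))"
    by (simp add: j mult.assoc)
  also have "\<dots> = (?P t * down (Suc t + j - n) (p (Suc t))) * col j (Suc t)"
    using step by (simp only: col_absorb mult.assoc)
  also have "\<dots> = prod_list (map (\<lambda>j. col j (Suc t)) (rev [j..<2 * n]))"
    unfolding IH by (simp add: j)
  finally show ?case .
qed

text \<open>Each of the first n steps opens one new column, hence the lower end n + 1 - t; from t =
  n on all columns are open.\<close>

definition state :: "nat \<Rightarrow> 'm" where
  "state t = prod_list (map (\<lambda>j. col j t) (rev [n + 1 - min t n..<2 * n]))"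

lemma state_0: "state 0 = prod_list (map (\<lambda>j. up j (b j)) (rev [1..<n]))"
proof -
  have "[n + 1..<2 * n] = map (\<lambda>j. j + n) [1..<n]"
    by (rule nth_equalityI) auto
  then have "rev [n + 1..<2 * n] = map (\<lambda>j. j + n) (rev [1..<n])"
    by (simp only: rev_map)
  moreover have "col (j + n) 0 = up j (b j)" if "1 \<le> j" for j
    using that by (simp add: col_def lo_def q_def)
  ultimately show ?thesis
    by (simp add: state_def comp_def) (intro arg_cong[where f = prod_list] map_cong; simp)
qed

text \<open>Row t + 1 and column n - t carry the same variable. The decreasing half of F crosses the
  open columns as row t + 1; its middle factor and increasing half become column n - t with the
  diagonal box filled.\<close>

lemma state_F:
  assumes "t < n"
  shows "state (Suc t) = state t * F (x (n - t))"
proof -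
  let ?z = "x (n - t)"
  have t: "Suc (n - Suc t) = n - t" "n + 1 - min t n = n + 1 - t" "n + 1 - min (Suc t) n = n - t"
    using assms by auto
  have pz: "p (Suc t) = ?z"
    using assms by (simp add: p_def)
  have box: "box (Suc t) (n - t) = h 0 (diag ?z)"
    using box_diag[of "n - t"] assms by simp
  have "col (n - t) (Suc t) = h 0 (diag ?z) * up 1 ?z"
    using assms box by (simp add: col_def lo_def q_def min_def)
  moreover have "[n - t..<2 * n] = (n - t) # [n + 1 - t..<2 * n]"
    using assms by (simp add: upt_conv_Cons Suc_diff_le)
  moreover have "state t * down 1 ?z = prod_list (map (\<lambda>j. col j (Suc t)) (rev [n + 1 - t..<2 * n]))"
    using cols_absorb[of t "n + 1 - t"] assms by (simp add: state_def t pz)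
  ultimately show ?thesis
    unfolding state_def t F_def by (simp add: state_def t flip: mult.assoc)
qed

lemma state_a:
  assumes "n \<le> t"
  shows "state (Suc t) = state t * down (t + 1 - n) (a (t + 1 - n))"
  using cols_absorb[of t 1] assms n by (simp add: state_def p_def)

lemma state_n: "state n = state 0 * prod_list (map (\<lambda>i. F (x i)) [1..<n + 1])"
proof -
  have "t \<le> n \<Longrightarrow> state t = state 0 * prod_list (map (\<lambda>i. F (x (n - i))) [0..<t])" for t
  proof (induction t)
    case (Suc t)
    then show ?case
      using state_F[of t] by (simp add: mult.assoc)
  qed simp
  from this[OF order_refl]
  have "state n = state 0 * prod_list (map (\<lambda>i. F (x (n - i))) [0..<n])" .
  also have "map (\<lambda>i. F (x (n - i))) [0..<n] = rev (map (\<lambda>i. F (x i)) [1..<n + 1])"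
    by (rule nth_equalityI) (auto simp: rev_nth Suc_diff_Suc simp del: upt_Suc)
  also have "prod_list \<dots> = prod_list (map (\<lambda>i. F (x i)) [1..<n + 1])"
    by (rule prod_list_rev_commute) (auto simp del: upt_Suc intro: F_commute[OF n nonzero])
  finally show ?thesis .
qed

lemma state_final:
  "state (2 * n - 1) = state n * prod_list (map (\<lambda>i. down i (a i)) [1..<n])"
proof -
  have "state (n + t) = state n * prod_list (map (\<lambda>i. down i (a i)) [1..<Suc t])" for t
  proof (induction t)
    case (Suc t)
    have "state (Suc (n + t)) = state (n + t) * down (Suc t) (a (Suc t))"
      using state_a[of "n + t"] by simp
    then show ?case
      using Suc by (simp add: mult.assoc)
  qed simp
  from this[of "n - 1"] show ?thesis
    using n by (simp add: mult_2 del: upt_Suc)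
qed

text \<open>At t = 2n - 1 every column is complete, since t + j - n \<ge> n for j \<ge> 1.\<close>

lemma state_boxes: "state (2 * n - 1) = prod_list (map (\<lambda>(i, j). box i j) (boxes n))"
proof -
  have col: "col j (2 * n - 1) = prod_list (map (\<lambda>i. box i j) [lo j..<2 * n - j + 1])" if "1 \<le> j" for j
  proof -
    have "min (2 * n - 1) (2 * n - j) = 2 * n - j" "n \<le> 2 * n - 1 + j - n"
      using that n by auto
    then show ?thesis
      by (simp add: col_def)
  qed
  have c1: "prod_list (map (\<lambda>i. box i j) [1..<2 * n - j + 1]) = col j (2 * n - 1)"
    if "j \<in> set (rev [n + 1..<2 * n])" for j
  proof -
    have "1 \<le> j" "lo j = 1"
      using that by (auto simp: lo_def)
    then show ?thesis
      by (simp only: col)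
  qed
  have c2: "prod_list (map (\<lambda>i. box i j) [n + 1 - j..<2 * n - j + 1]) = col j (2 * n - 1)"
    if "j \<in> set (rev [1..<n + 1])" for j
  proof -
    have "1 \<le> j" "lo j = n + 1 - j"
      using that by (auto simp: lo_def)
    then show ?thesis
      by (simp only: col)
  qed
  have split: "rev [1..<2 * n] = rev [n + 1..<2 * n] @ rev [1..<n + 1]"
  proof -
    have "[1..<2 * n] = [1..<n + 1] @ [n + 1..<2 * n]"
      using upt_add_eq_append[of 1 "n + 1" "n - 1"] n by (simp add: mult_2 del: upt_Suc)
    then show ?thesis
      by (simp only: rev_append)
  qed
  have con: "prod_list (map f (concat xss)) = prod_list (map (\<lambda>xs. prod_list (map f xs)) xss)"
    for f :: "nat \<times> nat \<Rightarrow> 'm" and xss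
    by (induction xss) simp_all
  have "prod_list (map (\<lambda>(i, j). box i j) (boxes n)) =
     prod_list (map (\<lambda>j. prod_list (map (\<lambda>i. box i j) [1..<2 * n - j + 1])) (rev [n + 1..<2 * n])) *
     prod_list (map (\<lambda>j. prod_list (map (\<lambda>i. box i j) [n + 1 - j..<2 * n - j + 1])) (rev [1..<n + 1]))"
    unfolding boxes_def by (simp add: con comp_def)
  also have "\<dots> = prod_list (map (\<lambda>j. col j (2 * n - 1)) (rev [1..<2 * n]))"
    unfolding split map_append prod_list.append
    by (intro arg_cong2[where f = "(*)"] arg_cong[where f = prod_list] map_cong refl c1 c2)
  finally show ?thesis
    using n by (simp add: state_def)
qed

theorem boxes_factorization:
  "prod_list (map (\<lambda>j. up j (b j)) (rev [1..<n])) * prod_list (map (\<lambda>i. F (x i)) [1..<n + 1]) *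
     prod_list (map (\<lambda>i. down i (a i)) [1..<n]) =
   prod_list (map (\<lambda>(i, j). box i j) (boxes n))"
  using state_0 state_n state_final state_boxes by simp

end

section \<open>Subword expansion\<close>

text \<open>Endofunctions get a type of their own in order to be an instance of
  \<open>monoid_mult\<close>.\<close>

datatype 'f opr = Opr (app: "'f \<Rightarrow> 'f")

text \<open>The product is composition from left to right, to match right multiplication in \<open>id_alg\<close>.\<close>

instantiation opr :: (type) monoid_mult
begin

definition one_opr :: "'a opr" where
  "1 = Opr id"

definition times_opr :: "'a opr \<Rightarrow> 'a opr \<Rightarrow> 'a opr" where
  "S * T = Opr (app T \<circ> app S)"

instance
  by standard (simp_all add: one_opr_def times_opr_def comp_assoc)

end

lemma app_times [simp]: "app (S * T) f = app T (app S f)"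
  by (simp add: times_opr_def)

lemma app_one [simp]: "app 1 f = f"
  by (simp add: one_opr_def)

lemma opr_eqI: "(\<And>f. app S f = app T f) \<Longrightarrow> S = T"
  by (cases S; cases T) (auto simp: fun_eq_iff)

definition hop :: "'a::comm_ring_1 \<Rightarrow> nat \<Rightarrow> nat \<Rightarrow> 'a \<Rightarrow> ((int \<Rightarrow> int) \<Rightarrow> 'a) opr" where
  "hop \<beta> n i x = Opr (\<lambda>f v. f v + x * rho \<beta> n i f v)"

lemma app_hop: "app (hop \<beta> n i x) f = (\<lambda>v. f v + x * rho \<beta> n i f v)"
  by (simp add: hop_def)

text \<open>By linearity both sides expand into iterated \<open>rho\<close>; the quadratic and braid
  rules normalize these words and leave a polynomial identity.\<close>

lemma yang_baxter_hop: "yang_baxter \<beta> n (hop \<beta> n)" for \<beta> :: "'a::field"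
proof
  show "hop \<beta> n i 0 = 1" for i
    by (rule opr_eqI) (simp add: app_hop)
next
  fix i and x y :: 'a assume "i < n"
  note q = rho_quadratic[OF this, of \<beta>]
  show "hop \<beta> n i x * hop \<beta> n i y = hop \<beta> n i (fplus \<beta> x y)"
    by (intro opr_eqI ext)
      (simp only: app_times app_hop rho_add rho_scale q, simp add: fplus_def algebra_simps)
next
  fix i j and x y :: 'a assume ij: "i + 2 \<le> j" "j < n"
  show "hop \<beta> n i x * hop \<beta> n j y = hop \<beta> n j y * hop \<beta> n i x"
    by (intro opr_eqI ext)
      (simp only: app_times app_hop rho_add rho_scale rho_commute[OF ij], simp add: algebra_simps)
next
  fix i and x y :: 'a assume i: "1 \<le> i" "i + 1 < n"
  then have "i < n" by simp
  note q = rho_quadratic[OF this, of \<beta>] rho_quadratic[OF i(2), of \<beta>] rho_braid3[OF i, of \<beta>]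
  show "hop \<beta> n i y * hop \<beta> n (i + 1) (fplus \<beta> x y) * hop \<beta> n i x =
      hop \<beta> n (i + 1) x * hop \<beta> n i (fplus \<beta> x y) * hop \<beta> n (i + 1) y"
    by (intro opr_eqI ext)
      (simp only: app_times app_hop rho_add rho_scale q, simp add: fplus_def algebra_simps)
next
  fix X s Y d :: 'a assume n: "1 < n" and c: "X * s = Y * fplus \<beta> s d + X * d * (1 + \<beta> * Y)"
  from n have "0 < n" by simp
  note q = rho_quadratic[OF this, of \<beta>] rho_quadratic[OF n, of \<beta>] rho_braid4[OF n, of \<beta>]
  show "hop \<beta> n 1 d * hop \<beta> n 0 X * hop \<beta> n 1 s * hop \<beta> n 0 Y =
      hop \<beta> n 0 Y * hop \<beta> n 1 s * hop \<beta> n 0 X * hop \<beta> n 1 d"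
  proof (intro opr_eqI ext)
    fix f v
    \<comment> \<open>After expansion the sides differ only in the terms of the two words of length
      two, so the side condition is multiplied by their values.\<close>
    have "X * s * z = (Y * fplus \<beta> s d + X * d * (1 + \<beta> * Y)) * z" for z
      by (simp only: c)
    from this[of "rho \<beta> n 0 (rho \<beta> n 1 f) v"] this[of "rho \<beta> n 1 (rho \<beta> n 0 f) v"]
    show "app (hop \<beta> n 1 d * hop \<beta> n 0 X * hop \<beta> n 1 s * hop \<beta> n 0 Y) f v =
        app (hop \<beta> n 0 Y * hop \<beta> n 1 s * hop \<beta> n 0 X * hop \<beta> n 1 d) f v"
      by (simp only: app_times app_hop rho_add rho_scale q) (simp add: fplus_def algebra_simps)
  qed
qed

section \<open>Products of factors as lists\<close>

definition h_poly :: "nat \<times> 'a \<Rightarrow> free_word \<Rightarrow>\<^sub>0 'a::comm_ring_1" where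
  "h_poly = (\<lambda>(i, x). 1 + fa_const x * fa_mono [i])"

text \<open>One list of pairs of index and argument has two readings: \<open>h_word\<close> in the
  free algebra and \<open>op_word\<close> as an operator. The action translates between
  them.\<close>

definition h_word :: "(nat \<times> 'a) list \<Rightarrow> free_word \<Rightarrow>\<^sub>0 'a::comm_ring_1" where
  "h_word L = prod_list (map h_poly L)"

definition op_word :: "'a::comm_ring_1 \<Rightarrow> nat \<Rightarrow> (nat \<times> 'a) list \<Rightarrow> ((int \<Rightarrow> int) \<Rightarrow> 'a) opr" where
  "op_word \<beta> n L = prod_list (map (\<lambda>(i, x). hop \<beta> n i x) L)"

lemma h_word_append: "h_word (L @ M) = h_word L * h_word M"
  by (simp add: h_word_def)

lemma op_word_append: "op_word \<beta> n (L @ M) = op_word \<beta> n L * op_word \<beta> n M"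
  by (simp add: op_word_def)

lemma op_word_concat: "op_word \<beta> n (concat Ls) = prod_list (map (op_word \<beta> n) Ls)"
  by (induction Ls) (simp_all add: op_word_append, simp add: op_word_def)

lemma op_word_row: "op_word \<beta> n (map (\<lambda>k. (k, x)) ks) = prod_list (map (\<lambda>k. hop \<beta> n k x) ks)"
  by (simp add: op_word_def comp_def)

lemma h_poly_carrier: "i < n \<Longrightarrow> h_poly (i, x) \<in> carrier (free_alg n)"
  unfolding h_poly_def prod.case by (intro add_carrier mult_carrier one_carrier fa_const_carrier fa_mono_carrier) simp

lemma h_word_carrier: "fst ` set L \<subseteq> {..<n} \<Longrightarrow> h_word L \<in> carrier (free_alg n)"
  unfolding h_word_def by (induction L) (auto intro!: mult_carrier h_poly_carrier)

lemma act_h_word: "act \<beta> n (h_word L) f = app (op_word \<beta> n L) f"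
proof (induction L arbitrary: f)
  case (Cons ix L)
  have "act \<beta> n (h_poly ix) f = app (hop \<beta> n (fst ix) (snd ix)) f"
    by (simp add: h_poly_def case_prod_unfold act_add act_mult act_mono act_const app_hop rho_scale)
  then show ?case
    using Cons by (simp add: h_word_def op_word_def act_mult case_prod_unfold)
qed (simp add: h_word_def op_word_def)

lemma ring_prod_list_h_elem:
  assumes "set ks \<subseteq> {..<n}"
  shows "ring_prod_list (id_alg \<beta> n) (map (\<lambda>k. h_elem \<beta> n k x) ks) =
    id_class \<beta> n (h_word (map (\<lambda>k. (k, x)) ks))"
proof -
  have "map (\<lambda>k. h_elem \<beta> n k x) ks = map (id_class \<beta> n) (map h_poly (map (\<lambda>k. (k, x)) ks))"
    by (simp add: h_elem_def h_poly_def)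
  then show ?thesis
    unfolding h_word_def using assms
    by (simp only:) (intro ring_prod_list_id_class, auto intro: h_poly_carrier)
qed

lemma ring_prod_list_h_word:
  assumes "\<And>L. L \<in> set Ls \<Longrightarrow> fst ` set L \<subseteq> {..<n}"
  shows "ring_prod_list (id_alg \<beta> n) (map (\<lambda>L. id_class \<beta> n (h_word L)) Ls) =
    id_class \<beta> n (h_word (concat Ls))"
proof -
  have "h_word (concat Ls) = prod_list (map h_word Ls)"
    by (induction Ls) (simp_all add: h_word_append, simp add: h_word_def)
  moreover have "map (\<lambda>L. id_class \<beta> n (h_word L)) Ls = map (id_class \<beta> n) (map h_word Ls)"
    by simp
  ultimately show ?thesis
    using assms by (simp only:) (intro ring_prod_list_id_class, auto intro: h_word_carrier)
qed

definition down_row :: "nat \<Rightarrow> nat \<Rightarrow> 'a \<Rightarrow> (nat \<times> 'a) list" where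
  "down_row n m x = map (\<lambda>k. (k, x)) (rev [m..<n])"

definition up_row :: "nat \<Rightarrow> nat \<Rightarrow> 'a \<Rightarrow> (nat \<times> 'a) list" where
  "up_row n m x = map (\<lambda>k. (k, x)) [m..<n]"

definition F_row :: "bc_type \<Rightarrow> nat \<Rightarrow> 'a \<Rightarrow> (nat \<times> 'a) list" where
  "F_row X n x = map (\<lambda>k. (k, x))
     (rev [1..<n] @ (case X of TypeB \<Rightarrow> [0] | TypeC \<Rightarrow> [0, 0]) @ [1..<n])"

definition down_rows :: "nat \<Rightarrow> (nat \<Rightarrow> 'a) \<Rightarrow> (nat \<times> 'a) list" where
  "down_rows n a = concat (map (\<lambda>i. down_row n i (a i)) [1..<n])"

definition up_rows :: "nat \<Rightarrow> (nat \<Rightarrow> 'a) \<Rightarrow> (nat \<times> 'a) list" where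
  "up_rows n b = concat (map (\<lambda>i. up_row n i (b i)) (rev [1..<n]))"

definition F_rows :: "bc_type \<Rightarrow> nat \<Rightarrow> (nat \<Rightarrow> 'a) \<Rightarrow> (nat \<times> 'a) list" where
  "F_rows X n x = concat (map (\<lambda>i. F_row X n (x i)) [1..<n + 1])"

lemma rows_letters:
  shows "fst ` set (down_rows n a) \<subseteq> {..<n}" "fst ` set (up_rows n b) \<subseteq> {..<n}"
    and "1 \<le> n \<Longrightarrow> fst ` set (F_rows X n x) \<subseteq> {..<n}"
  by (cases X; auto simp: down_rows_def up_rows_def F_rows_def down_row_def up_row_def F_row_def)+

lemma G_A_eq: "G_A \<beta> n a = id_class \<beta> n (h_word (down_rows n a))"
proof -
  have "A_elem \<beta> n i x = id_class \<beta> n (h_word (down_row n i x))" for i x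
    unfolding A_elem_def down_row_def by (rule ring_prod_list_h_elem) auto
  then have "map (\<lambda>i. A_elem \<beta> n i (a i)) [1..<n] =
      map (\<lambda>L. id_class \<beta> n (h_word L)) (map (\<lambda>i. down_row n i (a i)) [1..<n])"
    by simp
  then show ?thesis
    unfolding G_A_def down_rows_def
    by (simp only:) (rule ring_prod_list_h_word, auto simp: down_row_def)
qed

lemma F_prod_eq:
  assumes "1 \<le> n"
  shows "F_prod X \<beta> n x = id_class \<beta> n (h_word (F_rows X n x))"
proof -
  have "F1 X \<beta> n z = id_class \<beta> n (h_word (F_row X n z))" for z
    unfolding F1_def F_row_def by (rule ring_prod_list_h_elem) (use assms in \<open>cases X; auto\<close>)
  then have "map (\<lambda>i. F1 X \<beta> n (x i)) [1..<n + 1] =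
      map (\<lambda>L. id_class \<beta> n (h_word L)) (map (\<lambda>i. F_row X n (x i)) [1..<n + 1])"
    by simp
  then show ?thesis
    unfolding F_prod_def F_rows_def
    by (simp only:) (rule ring_prod_list_h_word, use assms in \<open>cases X; auto simp: F_row_def\<close>)
qed

lemma prod_list_rev_inverse:
  fixes U D :: "'b \<Rightarrow> 'm::monoid_mult"
  assumes "\<And>i. U i * D i = 1"
  shows "prod_list (map U (rev is)) * prod_list (map D is) = 1"
proof (induction "is")
  case (Cons i "is")
  have "prod_list (map U (rev (i # is))) * prod_list (map D (i # is)) =
      prod_list (map U (rev is)) * (U i * D i) * prod_list (map D is)"
    by (simp add: mult.assoc)
  then show ?case
    by (simp only: assms Cons mult_1_right)
qed simp

context
  fixes \<beta> :: "'a::field" and n :: nat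
begin

interpretation yang_baxter \<beta> n "hop \<beta> n"
  by (rule yang_baxter_hop)

lemma op_word_down_rows: "op_word \<beta> n (down_rows n a) = prod_list (map (\<lambda>i. down i (a i)) [1..<n])"
  by (simp add: down_rows_def op_word_concat comp_def down_row_def op_word_row down_def)

lemma op_word_up_rows: "op_word \<beta> n (up_rows n b) = prod_list (map (\<lambda>i. up i (b i)) (rev [1..<n]))"
  by (simp add: up_rows_def op_word_concat comp_def up_row_def op_word_row up_def)

text \<open>Inverting reverses the factors and turns \<open>fminus \<beta> (b i)\<close> back into
  \<open>b i\<close>. Both products are 1 as operators, hence in the algebra by
  faithfulness.\<close>

lemma inv_G_A:
  assumes "\<And>i. 1 + \<beta> * b i \<noteq> 0"
  shows "inv\<^bsub>id_alg \<beta> n\<^esub> (G_A \<beta> n (\<lambda>i. fminus \<beta> (b i))) = id_class \<beta> n (h_word (up_rows n b))"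
proof -
  let ?D = "down_rows n (\<lambda>i. fminus \<beta> (b i))" and ?U = "up_rows n b"
  interpret Q: ring "id_alg \<beta> n" by (rule ring_id_alg)
  have "fplus \<beta> (b i) (fminus \<beta> (b i)) = 0" for i
    using assms[of i] by (simp add: fplus_def fminus_def) (simp add: divide_simps, simp add: algebra_simps)
  note inv = up_down_inverse[OF this]
  have UD: "op_word \<beta> n (?U @ ?D) = 1"
    unfolding op_word_append op_word_down_rows op_word_up_rows by (rule prod_list_rev_inverse) (rule inv)
  have "op_word \<beta> n (?D @ ?U) = 1"
    using prod_list_rev_inverse[of "\<lambda>i. down i (fminus \<beta> (b i))" "\<lambda>i. up i (b i)" "rev [1..<n]"] inv
    by (simp add: op_word_append op_word_down_rows op_word_up_rows)
  note one = UD this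
  have carr: "h_word ?D \<in> carrier (free_alg n)" "h_word ?U \<in> carrier (free_alg n)"
    by (intro h_word_carrier rows_letters)+
  have eq1: "id_class \<beta> n (h_word L) = \<one>\<^bsub>id_alg \<beta> n\<^esub>"
    if "op_word \<beta> n L = 1" "h_word L \<in> carrier (free_alg n)" for L
    using id_class_eqI[OF that(2) one_carrier, of \<beta>] that by (simp add: act_h_word id_class_one)
  have "id_class \<beta> n (h_word ?D) \<otimes>\<^bsub>id_alg \<beta> n\<^esub> id_class \<beta> n (h_word ?U) = \<one>\<^bsub>id_alg \<beta> n\<^esub>"
    and "id_class \<beta> n (h_word ?U) \<otimes>\<^bsub>id_alg \<beta> n\<^esub> id_class \<beta> n (h_word ?D) = \<one>\<^bsub>id_alg \<beta> n\<^esub>"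
    using eq1[OF one(2)] eq1[OF one(1)] carr by (simp_all add: h_word_append id_class_mult)
  then show ?thesis
    unfolding G_A_eq using carr by (intro Q.inv_unique'[symmetric]) simp_all
qed

end

text \<open>\<open>Wt\<close> for an arbitrary list of letters with weights, so that induction on
  the list is possible.\<close>

definition subword_wt :: "'a::comm_ring_1 \<Rightarrow> nat \<Rightarrow> (nat \<times> 'a) list \<Rightarrow> nat set \<Rightarrow> 'a" where
  "subword_wt \<beta> n L J =
     (\<Prod>j\<in>J. snd (L ! j)) * (\<Prod>j\<in>back_positions n (map fst L) J. 1 + \<beta> * snd (L ! j))"

lemma nths_snoc:
  assumes "A \<subseteq> {..<length ds}"
  shows "nths (ds @ [d]) A = nths ds A" "nths (ds @ [d]) (insert (length ds) A) = nths ds A @ [d]"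
proof -
  have "nths ds (insert (length ds) A) = nths ds A"
    by (auto simp: nths_def intro!: arg_cong[where f = "map fst"] filter_cong dest: set_zip_rightD)
  then show "nths (ds @ [d]) A = nths ds A" "nths (ds @ [d]) (insert (length ds) A) = nths ds A @ [d]"
    using assms by (auto simp: nths_append nths_singleton)
qed

lemma finite_RSub: "finite (RSub n ds v)"
  by (rule finite_subset[of _ "Pow {..<length ds}"]) (auto simp: RSub_def)

text \<open>If the last position is selected, the others spell v s_i with one letter less than the
  length of v, which makes i a descent.\<close>

lemma RSub_snoc:
  assumes v: "v \<in> signed_perms n" and ds: "set ds \<subseteq> {..<n}" and i: "i < n"
  shows "RSub n (ds @ [i]) v =
    RSub n ds v \<union> (if des i v then insert (length ds) ` RSub n ds (v \<circ> refl_gen i) else {})"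
    (is "?L = ?R")
proof
  show "?L \<subseteq> ?R"
  proof
    fix J assume J: "J \<in> ?L"
    show "J \<in> ?R"
    proof (cases "length ds \<in> J")
      case False
      then have "J \<subseteq> {..<length ds}"
        using J by (auto simp: RSub_def less_Suc_eq)
      then show ?thesis
        using J by (simp add: RSub_def nths_snoc)
    next
      case True
      define K where "K = J - {length ds}"
      have JK: "J = insert (length ds) K" and K: "K \<subseteq> {..<length ds}" "length ds \<notin> K"
        using J True by (auto simp: K_def RSub_def less_Suc_eq)
      have fin: "finite K"
        using K(1) finite_subset by blast
      have card: "Suc (card K) = cox_length n v"
        using J K fin by (simp add: RSub_def JK)
      have w: "word_perm (nths ds K) \<circ> refl_gen i = v"
        using J by (simp add: RSub_def JK nths_snoc(2)[OF K(1)])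
      then have u: "word_perm (nths ds K) = v \<circ> refl_gen i"
        by auto
      have "length (nths ds K) = card K"
        using K(1) by (auto simp: length_nths intro: arg_cong[where f = card])
      moreover have "set (nths ds K) \<subseteq> {..<n}"
        using ds set_nths_subset by fast
      ultimately have "cox_length n (v \<circ> refl_gen i) < cox_length n v"
        using cox_length_le_length[of "nths ds K" n] card u by simp
      then have d: "des i v"
        using cox_length_comp_less_iff[OF v i] by simp
      then have "K \<in> RSub n ds (v \<circ> refl_gen i)"
        using K card u cox_length_descent[OF v i d] by (simp add: RSub_def)
      then show ?thesis
        using d JK by simp
    qed
  qed
  show "?R \<subseteq> ?L"
  proof
    fix J assume "J \<in> ?R"
    then consider "J \<in> RSub n ds v"
      | K where "des i v" "K \<in> RSub n ds (v \<circ> refl_gen i)" "J = insert (length ds) K"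
      by (auto split: if_splits)
    then show "J \<in> ?L"
    proof cases
      case 1
      then show ?thesis
        by (auto simp: RSub_def nths_snoc)
    next
      case 2
      then have K: "K \<subseteq> {..<length ds}" by (simp add: RSub_def)
      then have "length ds \<notin> K" "finite K"
        using finite_subset by auto
      then show ?thesis
        using 2 K cox_length_descent[OF v i 2(1)] by (auto simp: RSub_def nths_snoc)
    qed
  qed
qed

lemma back_positions_less: "back_positions n ds J \<subseteq> {..<length ds}"
  by (auto simp: back_positions_def)

lemma back_positions_snoc_eqI:
  assumes "\<And>j. j < length ds \<Longrightarrow> j \<in> back_positions n (ds @ [i]) J \<longleftrightarrow> j \<in> B"
    and "length ds \<in> back_positions n (ds @ [i]) J \<longleftrightarrow> length ds \<in> B"
    and "B \<subseteq> {..length ds}"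
  shows "back_positions n (ds @ [i]) J = B"
proof (rule Set.set_eqI)
  fix j
  have "j \<notin> back_positions n (ds @ [i]) J" "j \<notin> B" if "length ds < j"
    using that assms(3) by (auto simp: back_positions_def)
  then show "j \<in> back_positions n (ds @ [i]) J \<longleftrightarrow> j \<in> B"
    using assms(1,2) by (cases j "length ds" rule: linorder_cases) auto
qed

lemma back_positions_snoc_keep:
  assumes "J \<in> RSub n ds v" "v \<in> signed_perms n" "i < n"
  shows "back_positions n (ds @ [i]) J =
    back_positions n ds J \<union> (if des i v then {length ds} else {})"
proof -
  let ?N = "length ds"
  have J: "J \<subseteq> {..<?N}" "card J = cox_length n v" "word_perm (nths ds J) = v"
    using assms(1) by (auto simp: RSub_def)
  have nths: "nths (ds @ [i]) (J \<inter> {..<j}) = nths ds (J \<inter> {..<j})" for j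
    using J(1) by (intro nths_snoc) auto
  have "j \<in> back_positions n (ds @ [i]) J \<longleftrightarrow> j \<in> back_positions n ds J" if "j < ?N" for j
    using that by (simp add: back_positions_def nths nth_append)
  moreover have "?N \<in> back_positions n (ds @ [i]) J \<longleftrightarrow> des i v"
  proof -
    have "J \<inter> {..<?N} = J" "?N \<notin> J"
      using J(1) by auto
    \<comment> \<open>A descent excludes the identity, so the selected subword is not empty.\<close>
    moreover have "\<exists>k\<in>J. k < ?N" if "des i v"
    proof -
      have "J \<noteq> {}"
        using J(2) cox_length_descent[OF assms(2,3) that] by auto
      then show ?thesis
        using J(1) by auto
    qed
    ultimately show ?thesis
      using cox_length_comp_less_iff[OF assms(2,3)] J(3) nths[of ?N]
      by (auto simp: back_positions_def simp del: o_apply)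
  qed
  ultimately show ?thesis
    by (intro back_positions_snoc_eqI) (auto dest: back_positions_less[THEN subsetD])
qed

text \<open>Truncation at j hides the new position from the tests at all earlier positions.\<close>

lemma back_positions_snoc_insert:
  assumes "J \<subseteq> {..<length ds}"
  shows "back_positions n (ds @ [i]) (insert (length ds) J) = back_positions n ds J"
proof -
  let ?N = "length ds"
  have nths: "nths (ds @ [i]) (J \<inter> {..<j}) = nths ds (J \<inter> {..<j})" for j
    using assms by (intro nths_snoc) auto
  have "j \<in> back_positions n (ds @ [i]) (insert ?N J) \<longleftrightarrow> j \<in> back_positions n ds J" if "j < ?N" for j
  proof -
    have "insert ?N J \<inter> {..<j} = J \<inter> {..<j}"
      using that by auto
    then show ?thesis
      using that by (auto simp: back_positions_def nths nth_append)
  qed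
  moreover have "?N \<notin> back_positions n (ds @ [i]) (insert ?N J)"
    by (simp add: back_positions_def)
  ultimately show ?thesis
    by (intro back_positions_snoc_eqI) (auto dest: back_positions_less[THEN subsetD])
qed

lemma subword_wt_snoc_keep:
  assumes "J \<in> RSub n (map fst L) v" "v \<in> signed_perms n" "i < n"
  shows "subword_wt \<beta> n (L @ [(i, x)]) J = (if des i v then 1 + \<beta> * x else 1) * subword_wt \<beta> n L J"
proof -
  have J: "J \<subseteq> {..<length L}"
    using assms(1) by (auto simp: RSub_def)
  let ?B = "back_positions n (map fst L) J"
  have B: "?B \<subseteq> {..<length L}" "finite ?B"
    using back_positions_less[of n "map fst L" J] finite_subset by auto
  have bp: "back_positions n (map fst (L @ [(i, x)])) J = (if des i v then insert (length L) ?B else ?B)"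
    using back_positions_snoc_keep[OF assms] by simp
  have "(\<Prod>j\<in>J. snd ((L @ [(i, x)]) ! j)) = (\<Prod>j\<in>J. snd (L ! j))"
    using J by (intro prod.cong) (auto simp: nth_append)
  moreover have "(\<Prod>j\<in>?B. 1 + \<beta> * snd ((L @ [(i, x)]) ! j)) = (\<Prod>j\<in>?B. 1 + \<beta> * snd (L ! j))"
    using B by (intro prod.cong) (auto simp: nth_append)
  moreover have "length L \<notin> ?B"
    using B by auto
  ultimately show ?thesis
    unfolding subword_wt_def bp using B by (simp add: mult.left_commute)
qed

lemma subword_wt_snoc_insert:
  assumes "J \<subseteq> {..<length L}"
  shows "subword_wt \<beta> n (L @ [(i, x)]) (insert (length L) J) = x * subword_wt \<beta> n L J"
proof -
  let ?B = "back_positions n (map fst L) J"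
  have B: "?B \<subseteq> {..<length L}"
    using back_positions_less[of n "map fst L" J] by simp
  have bp: "back_positions n (map fst (L @ [(i, x)])) (insert (length L) J) = ?B"
    using back_positions_snoc_insert[of J "map fst L" n i] assms by simp
  have "(\<Prod>j\<in>J. snd ((L @ [(i, x)]) ! j)) = (\<Prod>j\<in>J. snd (L ! j))"
    using assms by (intro prod.cong) (auto simp: nth_append)
  moreover have "(\<Prod>j\<in>?B. 1 + \<beta> * snd ((L @ [(i, x)]) ! j)) = (\<Prod>j\<in>?B. 1 + \<beta> * snd (L ! j))"
    using B by (intro prod.cong) (auto simp: nth_append)
  moreover have "length L \<notin> J" "finite J"
    using assms finite_subset by auto
  ultimately show ?thesis
    unfolding subword_wt_def bp by (simp add: mult.assoc)
qed

text \<open>Induction on the last factor, read at a fixed v: f becomes f(v) at an ascent and (1 +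
  \<beta> x) f(v) + x f(v s_i) at a descent. The two terms at a descent belong to the subwords that
  skip the last position, where it counts as a back position, and to those that use it.\<close>

lemma op_word_subword_expansion:
  assumes "fst ` set L \<subseteq> {..<n}" "v \<in> signed_perms n"
  shows "app (op_word \<beta> n L) unit_fun v = (\<Sum>J\<in>RSub n (map fst L) v. subword_wt \<beta> n L J)"
  using assms
proof (induction L arbitrary: v rule: rev_induct)
  case Nil
  have "RSub n [] v = (if v = id then {{}} else {})"
    by (auto simp: RSub_def)
  then show ?case
    by (simp add: op_word_def unit_fun_def basis_fun_def subword_wt_def back_positions_def)
next
  case (snoc ix L)
  obtain i x where ix: "ix = (i, x)" by fastforce
  let ?ds = "map fst L" and ?c = "app (op_word \<beta> n L) unit_fun"
  have i: "i < n" and L: "fst ` set L \<subseteq> {..<n}" and v: "v \<in> signed_perms n"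
    using snoc.prems ix by auto
  then have ds: "set ?ds \<subseteq> {..<n}" by simp
  have c: "?c u = (\<Sum>J\<in>RSub n ?ds u. subword_wt \<beta> n L J)" if "u \<in> signed_perms n" for u
    using snoc.IH[OF L that] .
  have lhs: "app (op_word \<beta> n (L @ [ix])) unit_fun v = ?c v + x * rho \<beta> n i ?c v"
    by (simp add: op_word_append ix op_word_def app_hop)
  have keep: "(\<Sum>J\<in>RSub n ?ds v. subword_wt \<beta> n (L @ [ix]) J) = (if des i v then 1 + \<beta> * x else 1) * ?c v"
    unfolding c[OF v] sum_distrib_left
    by (intro sum.cong refl) (simp only: ix subword_wt_snoc_keep[OF _ v i])
  have less: "J \<subseteq> {..<length L}" if "J \<in> RSub n ?ds u" for J u
    using that by (auto simp: RSub_def)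
  show ?case
  proof (cases "des i v")
    case False
    then have "RSub n (map fst (L @ [ix])) v = RSub n ?ds v"
      using RSub_snoc[OF v ds i] by (simp add: ix)
    then show ?thesis
      using keep False unfolding lhs by (simp add: rho_def)
  next
    case True
    let ?R = "RSub n ?ds (v \<circ> refl_gen i)"
    have R: "RSub n (map fst (L @ [ix])) v = RSub n ?ds v \<union> insert (length L) ` ?R"
      using RSub_snoc[OF v ds i] True by (simp add: ix)
    have inj: "inj_on (insert (length L)) ?R"
    proof (rule inj_onI)
      fix J K assume "J \<in> ?R" "K \<in> ?R" and eq: "insert (length L) J = insert (length L) K"
      then have "length L \<notin> J" "length L \<notin> K"
        using less by blast+
      then show "J = K"
        using eq by (simp add: insert_ident)
    qed
    have disj: "RSub n ?ds v \<inter> insert (length L) ` ?R = {}"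
      using less by blast
    have "(\<Sum>J\<in>insert (length L) ` ?R. subword_wt \<beta> n (L @ [ix]) J) =
        (\<Sum>J\<in>?R. x * subword_wt \<beta> n L J)"
      unfolding sum.reindex[OF inj]
      by (intro sum.cong refl) (simp only: o_apply ix subword_wt_snoc_insert[OF less])
    also have "\<dots> = x * ?c (v \<circ> refl_gen i)"
      using c[of "v \<circ> refl_gen i"] v i by (simp add: sum_distrib_left)
    finally have "(\<Sum>J\<in>RSub n (map fst (L @ [ix])) v. subword_wt \<beta> n (L @ [ix]) J) =
        (1 + \<beta> * x) * ?c v + x * ?c (v \<circ> refl_gen i)"
      unfolding R using keep True
      by (subst sum.union_disjoint) (simp_all add: finite_RSub disj)
    then show ?thesis
      unfolding lhs using True v by (simp add: rho_def algebra_simps)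
  qed
qed

text \<open>The product of two indeterminates, equal or not, is a nontrivial monomial, so the
  constant coefficient is 1.\<close>

lemma one_plus_indet_mult_nonzero: "1 + indet u * indet v \<noteq> 0"
proof
  let ?m = "Poly_Mapping.single u 1 + Poly_Mapping.single v 1 :: nat \<times> nat \<Rightarrow>\<^sub>0 nat"
  let ?t = "Poly_Mapping.single ?m 1 :: ((nat \<times> nat) \<Rightarrow>\<^sub>0 nat) \<Rightarrow>\<^sub>0 int"
  assume "1 + indet u * indet v = 0"
  then have "Fract (1 + ?t) 1 = 0"
    by (simp add: indet_def One_fract_def mult_single)
  then have "1 + ?t = 0"
    by (simp add: Zero_fract_def eq_fract)
  then have "Poly_Mapping.lookup (1 + ?t) 0 = 0"
    by simp
  moreover have "Poly_Mapping.lookup ?m u \<noteq> 0"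
    by (simp add: lookup_add)
  then have "?m \<noteq> 0"
    by (metis lookup_zero)
  ultimately show False
    by (simp add: lookup_add lookup_single)
qed

theorem theorem5:
  fixes X :: bc_type and n :: nat and w :: "int \<Rightarrow> int"
  assumes "n \<ge> 1" and "w \<in> signed_perms n"
  shows "groth X beta_var n w a_var b_var x_var =
    (\<Sum>J \<in> RSub n (map (box_refl n) (boxes n)) w. Wt X beta_var n a_var b_var x_var J)"
proof -
  let ?\<beta> = beta_var
  interpret board ?\<beta> n "hop ?\<beta> n" X a_var b_var x_var
  proof -
    interpret yang_baxter ?\<beta> n "hop ?\<beta> n" by (rule yang_baxter_hop)
    show "board ?\<beta> n (hop ?\<beta> n) x_var"
      by unfold_locales (use assms(1) in \<open>auto simp: beta_var_def x_var_def one_plus_indet_mult_nonzero\<close>)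
  qed
  interpret Q: ring "id_alg ?\<beta> n" by (rule ring_id_alg)
  let ?U = "up_rows n b_var" and ?F = "F_rows X n x_var" and ?D = "down_rows n a_var"
  define L where "L = map (\<lambda>d. (box_refl n d, box_wt X ?\<beta> n a_var b_var x_var d)) (boxes n)"
  \<comment> \<open>Merges the two adjacent factors with index 0 of type C into the one with
    argument \<open>diag z\<close>.\<close>
  have "hop ?\<beta> n 0 z * (hop ?\<beta> n 0 z * S) = hop ?\<beta> n 0 (fplus ?\<beta> z z) * S" for z S
    using h_fplus[of 0 z z] assms(1) by (simp flip: mult.assoc)
  then have "op_word ?\<beta> n (F_row X n z) = F z" for z
    unfolding F_def diag_def down_def up_def F_row_def op_word_row
    by (cases X) (simp_all add: mult.assoc)
  then have F: "op_word ?\<beta> n ?F = prod_list (map (\<lambda>i. F (x_var i)) [1..<n + 1])"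
    by (simp add: F_rows_def op_word_concat comp_def)
  have "op_word ?\<beta> n L = prod_list (map (\<lambda>(i, j). box i j) (boxes n))"
    by (simp add: L_def op_word_def box_def comp_def case_prod_unfold)
  then have boxes: "op_word ?\<beta> n (?U @ ?F @ ?D) = op_word ?\<beta> n L"
    by (simp only: op_word_append F op_word_up_rows op_word_down_rows boxes_factorization
        flip: mult.assoc)
  have carr: "h_word ?U \<in> carrier (free_alg n)" "h_word ?F \<in> carrier (free_alg n)"
    "h_word ?D \<in> carrier (free_alg n)"
    using assms(1) by (intro h_word_carrier rows_letters; simp)+
  have fstL: "map fst L = map (box_refl n) (boxes n)" and nthL: "j < length (boxes n) \<Longrightarrow>
      snd (L ! j) = box_wt X ?\<beta> n a_var b_var x_var (boxes n ! j)" for j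
    by (simp_all add: L_def)
  \<comment> \<open>Rows in column j stop at 2n - j, so i + j - n - 1 is at most n - 1.\<close>
  have letters: "fst ` set L \<subseteq> {..<n}"
    by (auto simp: L_def boxes_def box_refl_def)
  have nz: "1 + ?\<beta> * b_var i \<noteq> 0" for i
    by (simp add: beta_var_def b_var_def one_plus_indet_mult_nonzero)
  have "inv\<^bsub>id_alg ?\<beta> n\<^esub> (G_A ?\<beta> n (\<lambda>i. fminus ?\<beta> (b_var i))) \<otimes>\<^bsub>id_alg ?\<beta> n\<^esub> F_prod X ?\<beta> n x_var
      \<otimes>\<^bsub>id_alg ?\<beta> n\<^esub> G_A ?\<beta> n a_var = id_class ?\<beta> n (h_word (?U @ ?F @ ?D))"
    using carr assms(1) inv_G_A[of ?\<beta> b_var n, OF nz]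
    by (simp add: G_A_eq F_prod_eq h_word_append id_class_mult Q.m_assoc)
  then have "groth X ?\<beta> n w a_var b_var x_var = act ?\<beta> n (h_word (?U @ ?F @ ?D)) unit_fun w"
    unfolding groth_def using u_coeff_id_class[OF _ assms(2), of "h_word (?U @ ?F @ ?D)" ?\<beta>] carr
    by (simp add: h_word_append)
  also have "\<dots> = app (op_word ?\<beta> n L) unit_fun w"
    by (simp only: act_h_word boxes)
  also have "\<dots> = (\<Sum>J \<in> RSub n (map fst L) w. subword_wt ?\<beta> n L J)"
    by (rule op_word_subword_expansion[OF letters assms(2)])
  also have "\<dots> = (\<Sum>J \<in> RSub n (map (box_refl n) (boxes n)) w. Wt X ?\<beta> n a_var b_var x_var J)"
    unfolding fstL
  proof (rule sum.cong[OF refl])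
    fix J assume "J \<in> RSub n (map (box_refl n) (boxes n)) w"
    then have J: "J \<subseteq> {..<length (boxes n)}"
      by (auto simp: RSub_def)
    show "subword_wt ?\<beta> n L J = Wt X ?\<beta> n a_var b_var x_var J"
      unfolding subword_wt_def Wt_def fstL
      using J back_positions_less[of n "map (box_refl n) (boxes n)" J]
      by (intro arg_cong2[where f = "(*)"] prod.cong refl) (auto simp: nthL)
  qed
  finally show ?thesis .
qed

end
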